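(* $E_C^\bullet=(A_C\oplus d(A_C),d)$, where $A_C$ is in degree $0$ and $d(A_C)$ in degree $1$ (equality of sub-dgas of $\Omega^\bullet_{hol}(\tilde C)$).
   Context: The base field is $\mathbb C$. $C$ is a smooth connected complex affine algebraic curve, also viewed as a Riemann surface; $p:\tilde C\to C$ is a universal cover; $\mathcal O(C)$, $\Omega(C)$ are the regular functions and regular differentials on $C$. $\Omega^\bullet(C)=(\mathcal O(C)\oplus\Omega(C),d)$ is the dga (differential graded algebra) of algebraic differential forms on $C$, and $\Omega_{hol}^\bullet(\tilde C)=(\mathcal O_{hol}(\tilde C)\oplus\Omega_{hol}(\tilde C),d)$ the dga of holomorphic differential forms on $\tilde C$, both in degrees $0,1$; $\Omega^\bullet(C)$ is viewed as a sub-dga of $\Omega^\bullet_{hol}(\tilde C)$ via $p^*$. An acyclic extension (AE) of $\Omega^\bullet(C)$ is a dga $E^\bullet$ with $\Omega^\bullet(C)\subset E^\bullet\subset\Omega_{hol}^\bullet(\tilde C)$ (inclusions of sub-dgas) and $\mathrm H^1(E^\bullet)=0$. $E_C^\bullet$ is the intersection of all AEs of $\Omega^\bullet(C)$ (it is itself an AE, the minimal one). $A_C$ is the intersection of all unital subalgebras $A\subset\mathcal O_{hol}(\tilde C)$ such that $z\mapsto\int_{z_0}^zf\,p^*\omega$ is in $A$ for all $f\in A$, $\omega\in\Omega(C)$, $z_0\in\tilde C$. *)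

theory Defs
  imports "HOL-Complex_Analysis.Complex_Analysis" "HOL-Library.Extended_Nat"
begin

section \<open>Affine algebraic curves\<close>

inductive_set polynomial_functions :: "(complex ^ 'n \<Rightarrow> complex) set" where
  const: "(\<lambda>x. c) \<in> polynomial_functions"
| coord: "(\<lambda>x. x $ i) \<in> polynomial_functions"
| add: "f \<in> polynomial_functions \<Longrightarrow> g \<in> polynomial_functions \<Longrightarrow> (\<lambda>x. f x + g x) \<in> polynomial_functions"
| mult: "f \<in> polynomial_functions \<Longrightarrow> g \<in> polynomial_functions \<Longrightarrow> (\<lambda>x. f x * g x) \<in> polynomial_functions"

definition zariski_closed :: "(complex ^ 'n) set \<Rightarrow> bool" where
  "zariski_closed Z \<longleftrightarrow> (\<exists>F \<subseteq> polynomial_functions. Z = {x. \<forall>f \<in> F. f x = 0})"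

definition zariski_connected :: "(complex ^ 'n) set \<Rightarrow> bool" where
  "zariski_connected Z \<longleftrightarrow>
     \<not> (\<exists>V W. zariski_closed V \<and> zariski_closed W \<and> V \<noteq> {} \<and> W \<noteq> {} \<and> V \<inter> W = {} \<and> Z = V \<union> W)"

definition zariski_irreducible :: "(complex ^ 'n) set \<Rightarrow> bool" where
  "zariski_irreducible Z \<longleftrightarrow> zariski_closed Z \<and> Z \<noteq> {} \<and>
     (\<forall>V W. zariski_closed V \<and> zariski_closed W \<and> Z = V \<union> W \<longrightarrow> Z = V \<or> Z = W)"

definition zariski_dim :: "(complex ^ 'n) set \<Rightarrow> enat" where
  "zariski_dim Z = Sup {enat m | m. \<exists>V :: nat \<Rightarrow> (complex ^ 'n) set.
     (\<forall>i\<le>m. zariski_irreducible (V i) \<and> V i \<subseteq> Z) \<and> (\<forall>i<m. V i \<subset> V (Suc i))}"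

definition vanishing_ideal :: "(complex ^ 'n) set \<Rightarrow> (complex ^ 'n \<Rightarrow> complex) set" where
  "vanishing_ideal Z = {f \<in> polynomial_functions. \<forall>x \<in> Z. f x = 0}"

text \<open>The differential of \<open>f\<close> at \<open>x\<close>, evaluated at the vector \<open>v\<close>.\<close>

definition differential_at :: "(complex ^ 'n \<Rightarrow> complex) \<Rightarrow> complex ^ 'n \<Rightarrow> complex ^ 'n \<Rightarrow> complex" where
  "differential_at f x v = deriv (\<lambda>t. f (x + t *s v)) 0"

definition tangent_space :: "(complex ^ 'n) set \<Rightarrow> complex ^ 'n \<Rightarrow> (complex ^ 'n) set" where
  "tangent_space Z x = {v. \<forall>f \<in> vanishing_ideal Z. differential_at f x v = 0}"

definition smooth_connected_affine_curve :: "(complex ^ 'n) set \<Rightarrow> bool" where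
  "smooth_connected_affine_curve C \<longleftrightarrow>
     zariski_closed C \<and> zariski_connected C \<and> zariski_dim C = 1 \<and>
     (\<forall>x \<in> C. vec.dim (tangent_space C x) = 1)"

definition regular_functions :: "(complex ^ 'n) set \<Rightarrow> (complex ^ 'n \<Rightarrow> complex) set" where
  "regular_functions C = (\<lambda>f. restrict f C) ` polynomial_functions"

text \<open>
  A differential on \<open>C\<close> is a section of the cotangent bundle: it assigns to \<open>x \<in> C\<close> a linear form
  on \<open>tangent_space C x\<close> (extended by \<open>0\<close> outside, so that equality of functions is equality of
  sections). The regular ones are the finite sums \<open>\<Sum>i. f i d(g i)\<close> of regular functions; the
  restriction to the tangent spaces makes the choice of polynomial representatives immaterial.
\<close>

definition regular_differentials :: "(complex ^ 'n) set \<Rightarrow> (complex ^ 'n \<Rightarrow> complex ^ 'n \<Rightarrow> complex) set" where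
  "regular_differentials C = {\<omega>. \<exists>(m::nat) f g.
     (\<forall>i<m. f i \<in> polynomial_functions \<and> g i \<in> polynomial_functions) \<and>
     \<omega> = (\<lambda>x v. if x \<in> C \<and> v \<in> tangent_space C x
                 then \<Sum>i<m. f i x * differential_at (g i) x v else 0)}"


section \<open>Riemann surfaces\<close>

text \<open>A chart is a coordinate neighbourhood with its coordinate function, whose values outside the
  neighbourhood are irrelevant. The underlying space of a surface is the whole type.\<close>

type_synonym 'a chart = "'a set \<times> ('a \<Rightarrow> complex)"

definition riemann_surface :: "'a::t2_space chart set \<Rightarrow> bool" where
  "riemann_surface \<A> \<longleftrightarrow>
     connected (UNIV :: 'a set) \<and>
     (\<Union>(U, \<phi>) \<in> \<A>. U) = UNIV \<and>
     (\<forall>(U, \<phi>) \<in> \<A>. open U \<and> open (\<phi> ` U) \<and> homeomorphism U (\<phi> ` U) \<phi> (inv_into U \<phi>)) \<and>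
     (\<forall>(U, \<phi>) \<in> \<A>. \<forall>(V, \<psi>) \<in> \<A>. (\<psi> \<circ> inv_into U \<phi>) holomorphic_on \<phi> ` (U \<inter> V))"

definition holo_functions :: "'a::t2_space chart set \<Rightarrow> ('a \<Rightarrow> complex) set" where
  "holo_functions \<A> = {f. \<forall>(U, \<phi>) \<in> \<A>. (f \<circ> inv_into U \<phi>) holomorphic_on \<phi> ` U}"

text \<open>
  A differential \<open>\<omega>\<close> is represented by its coefficient functions: \<open>\<omega> = \<omega> (U, \<phi>) d\<phi>\<close> on \<open>U\<close>,
  subject to the transformation rule, with value \<open>0\<close> where the coefficient is not meaningful.
\<close>

type_synonym 'a form = "'a chart \<Rightarrow> 'a \<Rightarrow> complex"

definition holo_forms :: "'a::t2_space chart set \<Rightarrow> 'a form set" where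
  "holo_forms \<A> = {\<omega>.
     (\<forall>(U, \<phi>) \<in> \<A>. (\<omega> (U, \<phi>) \<circ> inv_into U \<phi>) holomorphic_on \<phi> ` U) \<and>
     (\<forall>(U, \<phi>) \<in> \<A>. \<forall>(V, \<psi>) \<in> \<A>. \<forall>z \<in> U \<inter> V.
        \<omega> (U, \<phi>) z = \<omega> (V, \<psi>) z * deriv (\<psi> \<circ> inv_into U \<phi>) (\<phi> z)) \<and>
     (\<forall>c z. c \<notin> \<A> \<or> z \<notin> fst c \<longrightarrow> \<omega> c z = 0)}"

definition ext_deriv :: "'a::t2_space chart set \<Rightarrow> ('a \<Rightarrow> complex) \<Rightarrow> 'a form" where
  "ext_deriv \<A> f = (\<lambda>(U, \<phi>) z.
     if (U, \<phi>) \<in> \<A> \<and> z \<in> U then deriv (f \<circ> inv_into U \<phi>) (\<phi> z) else 0)"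

definition fun_times_form :: "('a \<Rightarrow> complex) \<Rightarrow> 'a form \<Rightarrow> 'a form" where
  "fun_times_form f \<omega> = (\<lambda>c z. f z * \<omega> c z)"

definition piecewise_C1_path :: "'a::t2_space chart set \<Rightarrow> (real \<Rightarrow> 'a) \<Rightarrow> bool" where
  "piecewise_C1_path \<A> \<gamma> \<longleftrightarrow> path \<gamma> \<and>
     (\<forall>(U, \<phi>) \<in> \<A>. \<forall>a b. 0 \<le> a \<and> a \<le> b \<and> b \<le> 1 \<and> \<gamma> ` {a..b} \<subseteq> U \<longrightarrow>
        (\<phi> \<circ> \<gamma>) piecewise_C1_differentiable_on {a..b})"

text \<open>By the transformation rule, the integrand does not depend on the chart chosen at each point.\<close>

definition path_integral :: "'a::t2_space chart set \<Rightarrow> (real \<Rightarrow> 'a) \<Rightarrow> 'a form \<Rightarrow> complex" where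
  "path_integral \<A> \<gamma> \<omega> = integral {0..1} (\<lambda>t.
     let c = (SOME c. c \<in> \<A> \<and> \<gamma> t \<in> fst c)
     in \<omega> c (\<gamma> t) * vector_derivative (snd c \<circ> \<gamma>) (at t within {0..1}))"

text \<open>The common value of the integrals of \<open>\<omega>\<close> along the paths from \<open>z0\<close> to \<open>z\<close>; it exists on a
  simply connected surface.\<close>

definition integral_from_to :: "'a::t2_space chart set \<Rightarrow> 'a form \<Rightarrow> 'a \<Rightarrow> 'a \<Rightarrow> complex" where
  "integral_from_to \<A> \<omega> z0 z = (THE I. \<exists>\<gamma>. piecewise_C1_path \<A> \<gamma> \<and>
     pathstart \<gamma> = z0 \<and> pathfinish \<gamma> = z \<and> path_integral \<A> \<gamma> \<omega> = I)"


section \<open>The universal cover\<close>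

text \<open>
  The complex structure of a smooth curve \<open>C\<close> is the one of a complex submanifold of the affine
  space, so a map into \<open>C\<close> is holomorphic iff its coordinates are. A holomorphic covering map is
  locally biholomorphic, so the atlas of the cover is compatible with the structure lifted from \<open>C\<close>.
\<close>

definition universal_cover ::
    "'a::t2_space chart set \<Rightarrow> ('a \<Rightarrow> complex ^ 'n) \<Rightarrow> (complex ^ 'n) set \<Rightarrow> bool" where
  "universal_cover \<A> p C \<longleftrightarrow>
     riemann_surface \<A> \<and> simply_connected (UNIV :: 'a set) \<and> covering_space UNIV p C \<and>
     (\<forall>i. (\<lambda>z. p z $ i) \<in> holo_functions \<A>)"

definition pullback_form ::
    "'a::t2_space chart set \<Rightarrow> ('a \<Rightarrow> complex ^ 'n) \<Rightarrow> (complex ^ 'n \<Rightarrow> complex ^ 'n \<Rightarrow> complex) \<Rightarrow> 'a form" where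
  "pullback_form \<A> p \<omega> = (\<lambda>(U, \<phi>) z.
     if (U, \<phi>) \<in> \<A> \<and> z \<in> U
     then \<omega> (p z) (\<chi> i. deriv (\<lambda>t. p (inv_into U \<phi> t) $ i) (\<phi> z)) else 0)"


section \<open>Acyclic extensions\<close>

definition unital_subalgebra :: "('a \<Rightarrow> complex) set \<Rightarrow> bool" where
  "unital_subalgebra A \<longleftrightarrow> (\<lambda>z. 1) \<in> A \<and>
     (\<forall>f \<in> A. \<forall>g \<in> A. (\<lambda>z. f z + g z) \<in> A \<and> (\<lambda>z. f z * g z) \<in> A) \<and>
     (\<forall>a. \<forall>f \<in> A. (\<lambda>z. a * f z) \<in> A)"

text \<open>
  A graded subspace of the holomorphic de Rham algebra is given by its pair of components in degrees
  \<open>0\<close> and \<open>1\<close>. Products of two elements of degree \<open>1\<close>, and \<open>d\<close> on degree \<open>1\<close>, are zero.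
\<close>

definition sub_dga :: "'a::t2_space chart set \<Rightarrow> ('a \<Rightarrow> complex) set \<times> 'a form set \<Rightarrow> bool" where
  "sub_dga \<A> = (\<lambda>(E0, E1).
     E0 \<subseteq> holo_functions \<A> \<and> E1 \<subseteq> holo_forms \<A> \<and>
     unital_subalgebra E0 \<and>
     (\<lambda>c z. 0) \<in> E1 \<and>
     (\<forall>\<omega> \<in> E1. \<forall>\<eta> \<in> E1. (\<lambda>c z. \<omega> c z + \<eta> c z) \<in> E1) \<and>
     (\<forall>a. \<forall>\<omega> \<in> E1. (\<lambda>c z. a * \<omega> c z) \<in> E1) \<and>
     (\<forall>f \<in> E0. \<forall>\<omega> \<in> E1. fun_times_form f \<omega> \<in> E1) \<and>
     ext_deriv \<A> ` E0 \<subseteq> E1)"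

text \<open>All of \<open>E1\<close> consists of cocycles, so the first cohomology vanishes iff \<open>E1\<close> equals the
  space of coboundaries.\<close>

definition acyclic_extension ::
    "'a::t2_space chart set \<Rightarrow> ('a \<Rightarrow> complex ^ 'n) \<Rightarrow> (complex ^ 'n) set \<Rightarrow>
     ('a \<Rightarrow> complex) set \<times> 'a form set \<Rightarrow> bool" where
  "acyclic_extension \<A> p C = (\<lambda>(E0, E1).
     sub_dga \<A> (E0, E1) \<and>
     (\<lambda>f. f \<circ> p) ` regular_functions C \<subseteq> E0 \<and>
     pullback_form \<A> p ` regular_differentials C \<subseteq> E1 \<and>
     E1 = ext_deriv \<A> ` E0)"

definition minimal_acyclic_extension ::
    "'a::t2_space chart set \<Rightarrow> ('a \<Rightarrow> complex ^ 'n) \<Rightarrow> (complex ^ 'n) set \<Rightarrow>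
     ('a \<Rightarrow> complex) set \<times> 'a form set" where
  "minimal_acyclic_extension \<A> p C =
     (\<Inter>E \<in> {E. acyclic_extension \<A> p C E}. fst E, \<Inter>E \<in> {E. acyclic_extension \<A> p C E}. snd E)"

definition integration_algebra ::
    "'a::t2_space chart set \<Rightarrow> ('a \<Rightarrow> complex ^ 'n) \<Rightarrow> (complex ^ 'n) set \<Rightarrow> ('a \<Rightarrow> complex) set" where
  "integration_algebra \<A> p C = \<Inter> {A. A \<subseteq> holo_functions \<A> \<and> unital_subalgebra A \<and>
     (\<forall>f \<in> A. \<forall>\<omega> \<in> regular_differentials C. \<forall>z0.
        (\<lambda>z. integral_from_to \<A> (fun_times_form f (pullback_form \<A> p \<omega>)) z0 z) \<in> A)}"

end

theory Submission
  imports Defs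
begin

text \<open>
  Let \<open>B\<close> be the span of the iterated integrals: the least linear space containing the constants and
  all primitives of \<open>f p\<^sup>*\<omega>\<close> for \<open>f \<in> B\<close> and regular \<open>\<omega>\<close>. The shuffle relation makes \<open>B\<close> an algebra,
  so \<open>B = A\<^sub>C\<close>. Since \<open>dB\<close> is spanned by the forms \<open>f p\<^sup>*\<omega>\<close> with \<open>f \<in> B\<close>, it is a \<open>B\<close>-module, hence
  \<open>(B, dB)\<close> is an acyclic extension. Conversely, if \<open>(E0, E1)\<close> is an acyclic extension and \<open>f \<in> E0\<close>, then
  \<open>f p\<^sup>*\<omega> \<in> E1 = d E0\<close>, so \<open>E0\<close> is closed under integration and contains \<open>B\<close>.

  The analytic input is that holomorphic forms on a simply connected surface are exact. This is a
  purely topological monodromy statement: local primitives define an additive cocycle of local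
  increments, which can be continued along paths and along homotopies of loops.
\<close>

section \<open>Monodromy for local additive cocycles\<close>

text \<open>A homotopy supplied by simple connectedness is only continuous, so a form cannot be
  integrated along its intermediate loops. Increments of local primitives can be continued along any
  continuous map, which is why exactness is reduced to a statement about abstract cocycles. Once a
  global primitive exists, the integral of its differential along every piecewise C1 path is the
  difference of its end values; this, together with the existence of some path between any two
  points, gives the definite description in \<open>integral_from_to\<close> its value.

  Integration in \<open>integration_algebra\<close> fixes a base point, whereas acyclicity provides
  a primitive known only up to a constant. Admitting all primitives into B reconciles the two, since
  every algebra concerned contains the constants.

  An intersection of images under \<open>ext_deriv\<close> need not be the image of the
  intersection. Degree one causes no trouble because the intersections are attained at a single
  member of the family.\<close>

text \<open>\<open>D x y\<close> is the increment from \<open>x\<close> to \<open>y\<close> of a local primitive chosen near \<open>x\<close>; its value is irrelevant for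
  \<open>y\<close> away from \<open>x\<close>.\<close>

locale local_cocycle =
  fixes D :: "'a::topological_space \<Rightarrow> 'a \<Rightarrow> 'b::ab_group_add"
  assumes cocycle: "\<forall>\<^sub>F y in nhds x. \<forall>\<^sub>F z in nhds y. D x z = D x y + D y z"
begin

text \<open>A property that holds near a point holds at the point: take y = x and then z = x in the
  cocycle law.\<close>

lemma diag: "D x x = 0"
proof -
  have "\<forall>\<^sub>F z in nhds x. D x z = D x x + D x z"
    using eventually_nhds_x_imp_x[OF cocycle] .
  from eventually_nhds_x_imp_x[OF this] show ?thesis by simp
qed

text \<open>\<open>h\<close> is a primitive along the map \<open>H\<close>, such as a path or a homotopy of paths.\<close>

definition develops :: "('k::topological_space \<Rightarrow> 'a) \<Rightarrow> 'k set \<Rightarrow> ('k \<Rightarrow> 'b) \<Rightarrow> bool" where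
  "develops H K h \<longleftrightarrow> (\<forall>k\<in>K. \<forall>\<^sub>F l in at k within K. h l = h k + D (H k) (H l))"

section \<open>Uniqueness, pullback and gluing of developments\<close>

lemma develops_subset: "develops H K h \<Longrightarrow> L \<subseteq> K \<Longrightarrow> develops H L h"
  unfolding develops_def by (meson at_le filter_leD subsetD)

lemma develops_add_const: "develops H K h \<Longrightarrow> develops H K (\<lambda>k. h k + c)"
  unfolding develops_def by (auto simp: algebra_simps)

lemma develops_cong:
  assumes "develops H K h" and "\<And>k. k \<in> K \<Longrightarrow> h' k = h k" and "\<And>k. k \<in> K \<Longrightarrow> H' k = H k"
  shows "develops H' K h'"
  unfolding develops_def
proof
  fix k assume k: "k \<in> K"
  then have "\<forall>\<^sub>F l in at k within K. h l = h k + D (H k) (H l)"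
    using assms(1) by (auto simp: develops_def)
  moreover have "\<forall>\<^sub>F l in at k within K. l \<in> K"
    by (auto simp: eventually_at_filter)
  ultimately show "\<forall>\<^sub>F l in at k within K. h' l = h' k + D (H' k) (H' l)"
    by eventually_elim (use assms k in auto)
qed

text \<open>Both functions have the same increments near each point, so their difference is locally
  constant.\<close>

lemma develops_unique:
  assumes "connected K" "develops H K h" "develops H K h'"
  shows "(\<lambda>k. h k - h' k) constant_on K"
proof (rule locally_constant_imp_constant[OF assms(1)])
  fix k assume k: "k \<in> K"
  then have "\<forall>\<^sub>F l in at k within K. h l = h k + D (H k) (H l)"
    and "\<forall>\<^sub>F l in at k within K. h' l = h' k + D (H k) (H l)"
    using assms by (auto simp: develops_def)
  then have "\<forall>\<^sub>F l in at k within K. h l - h' l = h k - h' k"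
    by eventually_elim simp
  then obtain S where "open S" "k \<in> S" "\<forall>l\<in>S. l \<noteq> k \<longrightarrow> l \<in> K \<longrightarrow> h l - h' l = h k - h' k"
    unfolding eventually_at_topological by blast
  then show "\<exists>T. openin (top_of_set K) T \<and> k \<in> T \<and> (\<forall>l\<in>T. h l - h' l = h k - h' k)"
    using k by (intro exI[of _ "K \<inter> S"]) auto
qed

lemma develops_compose:
  assumes "develops H K h" "continuous_on L r" "r ` L \<subseteq> K"
  shows "develops (H \<circ> r) L (h \<circ> r)"
  unfolding develops_def
proof
  fix l assume l: "l \<in> L"
  then have "\<forall>\<^sub>F k in at (r l) within K. h k = h (r l) + D (H (r l)) (H k)"
    using assms by (auto simp: develops_def)
  \<comment> \<open>The punctured filter is left because \<open>r\<close> may take the value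
    \<open>r l\<close> at points other than \<open>l\<close>; at \<open>r l\<close> itself the
    equation holds by \<open>diag\<close>.\<close>
  then have "\<forall>\<^sub>F k in nhds (r l). k \<in> K \<longrightarrow> h k = h (r l) + D (H (r l)) (H k)"
    unfolding eventually_at_filter by eventually_elim (use diag in auto)
  moreover have "filterlim r (nhds (r l)) (at l within L)"
    using assms(2) l by (simp add: continuous_on_def)
  ultimately have "\<forall>\<^sub>F m in at l within L. r m \<in> K \<longrightarrow> h (r m) = h (r l) + D (H (r l)) (H (r m))"
    by (rule eventually_compose_filterlim)
  moreover have "\<forall>\<^sub>F m in at l within L. m \<in> L"
    by (auto simp: eventually_at_filter)
  ultimately show "\<forall>\<^sub>F m in at l within L. (h \<circ> r) m = (h \<circ> r) l + D ((H \<circ> r) l) ((H \<circ> r) m)"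
    by eventually_elim (use assms(3) in auto)
qed

text \<open>A point outside a closed set has a neighbourhood that misses it, so each of the two
  conditions also holds, vacuously, at the points of the other set.\<close>

lemma develops_Un:
  assumes "closed K" "closed L" "develops H K h" "develops H L h"
  shows "develops H (K \<union> L) h"
proof -
  have *: "\<forall>\<^sub>F l in at k within A. h l = h k + D (H k) (H l)"
    if "closed A" "develops H A h" for A k
  proof (cases "k \<in> A")
    case True
    then show ?thesis using that by (auto simp: develops_def)
  next
    case False
    then have "\<forall>\<^sub>F l in nhds k. l \<in> - A"
      using that by (intro eventually_nhds_in_open) auto
    then show ?thesis
      unfolding eventually_at_filter by eventually_elim auto
  qed
  show ?thesis
    unfolding develops_def at_within_union eventually_sup using * assms by auto
qed

text \<open>On the connected overlap the two developments differ by a constant, and shifting one of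
  them by it makes them agree.\<close>

lemma develops_glue:
  assumes "closed K" "closed L" "connected (K \<inter> L)" "develops H K h" "develops H L h'"
  shows "\<exists>g. develops H (K \<union> L) g"
proof -
  obtain c where c: "\<And>k. k \<in> K \<inter> L \<Longrightarrow> h k - h' k = c"
    using develops_unique[OF assms(3), of H h h'] assms(4,5) develops_subset
    unfolding constant_on_def by (metis Int_lower1 Int_lower2)
  define g where "g k = (if k \<in> K then h k else h' k + c)" for k
  have g: "g k = h' k + c" if "k \<in> L" for k
    using c[of k] that by (auto simp: g_def algebra_simps)
  have "develops H K g"
    using assms(4) by (rule develops_cong) (auto simp: g_def)
  moreover have "develops H L g"
    using develops_add_const[OF assms(5)] by (rule develops_cong) (auto simp: g)
  ultimately show ?thesis
    using develops_Un assms by blast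
qed

section \<open>Existence of developments along squares and paths\<close>

text \<open>Near \<open>x\<close> the single function \<open>D x\<close> has the prescribed
  increments at every point of \<open>N\<close>, so composing it with any map into \<open>N\<close>
  gives a development. The domain is left general in order to serve both squares and paths.\<close>

lemma develops_local:
  obtains N where "open N" "x \<in> N"
    "\<And>K (H :: 'k::topological_space \<Rightarrow> 'a). continuous_on K H \<Longrightarrow> H ` K \<subseteq> N \<Longrightarrow> develops H K (\<lambda>k. D x (H k))"
proof -
  obtain N where N: "open N" "x \<in> N" "\<And>y. y \<in> N \<Longrightarrow> \<forall>\<^sub>F z in nhds y. D x z = D x y + D y z"
    using cocycle[of x] unfolding eventually_nhds[of _ x] by metis
  have "develops H K (\<lambda>k. D x (H k))" if "continuous_on K H" "H ` K \<subseteq> N"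
    for K and H :: "'k \<Rightarrow> 'a"
    unfolding develops_def
  proof
    fix k assume k: "k \<in> K"
    then have "\<forall>\<^sub>F z in nhds (H k). D x z = D x (H k) + D (H k) z"
      using N that by auto
    moreover have "filterlim H (nhds (H k)) (at k within K)"
      using k that by (simp add: continuous_on_def)
    ultimately show "\<forall>\<^sub>F l in at k within K. D x (H l) = D x (H k) + D (H k) (H l)"
      by (rule eventually_compose_filterlim)
  qed
  with N show ?thesis using that by blast
qed

text \<open>Small rectangles are mapped into a set where one local primitive works. Neighbouring
  rectangles meet in an edge, which is connected, so their developments glue; subdivision in one
  coordinate and then in the other reaches the whole square.\<close>

lemma develops_square_exists:
  fixes H :: "real \<times> real \<Rightarrow> 'a"
  assumes H: "continuous_on ({0..1} \<times> {0..1}) H"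
  obtains h where "develops H ({0..1} \<times> {0..1}) h"
proof -
  \<comment> \<open>Here \<open>e\<close> bounds the height of the rectangles around level
    \<open>y\<close>. It is carried along because gluing two adjacent column ranges leaves only the
    smaller of their bounds.\<close>
  define Q where "Q y a b e \<longleftrightarrow> (\<forall>c d. 0 \<le> c \<longrightarrow> c \<le> y \<longrightarrow> y \<le> d \<longrightarrow> d \<le> 1 \<longrightarrow> d - c < e \<longrightarrow>
      (\<exists>h. develops H ({a..b} \<times> {c..d}) h))" for y a b e
  have strip: "\<exists>e>0. Q y 0 1 e" if y: "0 \<le> y" "y \<le> 1" for y
  proof -
    \<comment> \<open>The guards are needed because the local hypothesis of \<open>Bolzano\<close>
      also speaks of intervals that leave the unit interval.\<close>
    define P where "P a b \<longleftrightarrow> (0 \<le> a \<longrightarrow> b \<le> 1 \<longrightarrow> (\<exists>e>0. Q y a b e))" for a b :: real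
    have "P 0 1"
    proof (rule Bolzano)
      show "(0::real) \<le> 1" by simp
    next
      fix a b c assume *: "P a b" "P b c" "a \<le> b" "b \<le> c"
      show "P a c"
        unfolding P_def
      proof (intro impI)
        assume "0 \<le> a" "c \<le> 1"
        then have "b \<le> 1" "0 \<le> b" using * by auto
        then obtain e e' where e: "e > 0" "e' > 0" "Q y a b e" "Q y b c e'"
          using *(1,2) \<open>0 \<le> a\<close> \<open>c \<le> 1\<close> unfolding P_def by blast
        have "\<exists>h. develops H ({a..c} \<times> {u..d}) h"
          if ud: "0 \<le> u" "u \<le> y" "y \<le> d" "d \<le> 1" "d - u < min e e'" for u d
        proof -
          obtain h h' where "develops H ({a..b} \<times> {u..d}) h" "develops H ({b..c} \<times> {u..d}) h'"
            using e(3,4) ud unfolding Q_def by (metis min_less_iff_conj)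
          moreover have "{a..b} \<times> {u..d} \<inter> {b..c} \<times> {u..d} = {b} \<times> {u..d}"
            using * by auto
          moreover have "{a..b} \<times> {u..d} \<union> {b..c} \<times> {u..d} = {a..c} \<times> {u..d}"
            using * by auto
          ultimately show ?thesis
            using develops_glue[of "{a..b} \<times> {u..d}" "{b..c} \<times> {u..d}" H h h']
            by (auto simp: closed_Times connected_Times)
        qed
        then have "Q y a c (min e e')" unfolding Q_def by blast
        then show "\<exists>e>0. Q y a c e"
          using e(1,2) by (metis min_less_iff_conj)
      qed
    next
      fix x :: real assume x: "0 \<le> x" "x \<le> 1"
      obtain N where N: "open N" "H (x, y) \<in> N"
        "\<And>K (G :: real \<times> real \<Rightarrow> 'a). continuous_on K G \<Longrightarrow> G ` K \<subseteq> N \<Longrightarrow> develops G K (\<lambda>k. D (H (x,y)) (G k))"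
        using develops_local by blast
      have "(x, y) \<in> {0..1} \<times> {0..1}" using x y by auto
      then have "filterlim H (nhds (H (x, y))) (at (x, y) within {0..1} \<times> {0..1})"
        using H unfolding continuous_on_def by blast
      then have "\<forall>\<^sub>F k in at (x, y) within {0..1} \<times> {0..1}. H k \<in> N"
        using N topological_tendstoD by blast
      then obtain r where r: "r > 0" "\<And>k. k \<in> {0..1} \<times> {0..1} \<Longrightarrow> k \<noteq> (x,y) \<Longrightarrow> dist k (x,y) < r \<Longrightarrow> H k \<in> N"
        unfolding eventually_at by blast
      \<comment> \<open>Each side gets half of \<open>r\<close>, since the distance in the product
        is at most the sum of the coordinate distances.\<close>
      have "\<exists>h. develops H ({a..b} \<times> {c..d}) h"
        if "0 \<le> a" "a \<le> x" "x \<le> b" "b \<le> 1" "b - a < r/2" "0 \<le> c" "c \<le> y" "y \<le> d" "d \<le> 1" "d - c < r/2" for a b c d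
      proof -
        have sub: "{a..b} \<times> {c..d} \<subseteq> {0..1} \<times> {0..1}" using that by auto
        have "H (u, v) \<in> N" if uv: "u \<in> {a..b}" "v \<in> {c..d}" for u v
        proof -
          have "dist (u, v) (x, y) \<le> dist u x + dist v y"
            unfolding dist_Pair_Pair by (rule sqrt_sum_squares_le_sum) auto
          also have "\<dots> < r"
            using uv \<open>a \<le> x\<close> \<open>x \<le> b\<close> \<open>b - a < r/2\<close> \<open>c \<le> y\<close> \<open>y \<le> d\<close> \<open>d - c < r/2\<close> by (auto simp: dist_real_def)
          finally have "dist (u, v) (x, y) < r" .
          moreover have "(u, v) \<in> {0..1} \<times> {0..1}" using uv sub by blast
          ultimately show ?thesis using r(2)[of "(u, v)"] N(2) by metis
        qed
        then have "H ` ({a..b} \<times> {c..d}) \<subseteq> N" by auto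
        then show ?thesis by (intro exI) (rule N(3)[OF continuous_on_subset[OF H sub]])
      qed
      then have "Q y a b (r/2)" if "0 \<le> a" "a \<le> x" "x \<le> b" "b \<le> 1" "b - a < r/2" for a b
        unfolding Q_def using that by blast
      then show "\<exists>d>0. \<forall>a b. a \<le> x \<and> x \<le> b \<and> b - a < d \<longrightarrow> P a b"
        unfolding P_def using r(1) by (metis half_gt_zero)
    qed
    then show ?thesis by (simp add: P_def)
  qed
  \<comment> \<open>Around every level there is a strip of positive height with a development; a
    second subdivision, now in the second coordinate, stacks such strips.\<close>
  define P where "P c d \<longleftrightarrow> (0 \<le> c \<longrightarrow> d \<le> 1 \<longrightarrow> (\<exists>h. develops H ({0..1} \<times> {c..d}) h))" for c d
  have "P 0 1"
  proof (rule Bolzano)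
    show "(0::real) \<le> 1" by simp
  next
    fix a b c assume *: "P a b" "P b c" "a \<le> b" "b \<le> c"
    show "P a c"
      unfolding P_def
    proof (intro impI)
      assume "0 \<le> a" "c \<le> 1"
      then have "b \<le> 1" "0 \<le> b" using * by auto
      then obtain h h' where "develops H ({0..1} \<times> {a..b}) h" "develops H ({0..1} \<times> {b..c}) h'"
        using *(1,2) \<open>0 \<le> a\<close> \<open>c \<le> 1\<close> unfolding P_def by blast
      moreover have "{0..1::real} \<times> {a..b} \<inter> {0..1} \<times> {b..c} = {0..1} \<times> {b}"
        using * by auto
      moreover have "{0..1::real} \<times> {a..b} \<union> {0..1} \<times> {b..c} = {0..1} \<times> {a..c}"
        using * by auto
      ultimately show "\<exists>h. develops H ({0..1} \<times> {a..c}) h"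
        using develops_glue[of "{0..1} \<times> {a..b}" "{0..1} \<times> {b..c}" H h h']
        by (auto simp: closed_Times connected_Times)
    qed
  next
    fix y :: real assume "0 \<le> y" "y \<le> 1"
    from strip[OF this] show "\<exists>d>0. \<forall>a b. a \<le> y \<and> y \<le> b \<and> b - a < d \<longrightarrow> P a b"
      unfolding P_def Q_def by blast
  qed
  then show ?thesis using that by (auto simp: P_def)
qed

text \<open>A path is a homotopy that is constant in the second variable, so an edge of the square
  suffices.\<close>

lemma develops_path_exists:
  assumes "path \<gamma>"
  obtains h where "develops \<gamma> {0..1} h"
proof -
  have "continuous_on ({0..1} \<times> {0..1 :: real}) (\<gamma> \<circ> fst)"
    using assms unfolding path_def o_def by (rule continuous_on_compose2) (auto intro: continuous_on_fst)
  from develops_square_exists[OF this]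
  obtain h where "develops (\<gamma> \<circ> fst) ({0..1} \<times> {0..1 :: real}) h" .
  moreover have "continuous_on {0..1::real} (\<lambda>t. (t, 0::real))" "(\<lambda>t. (t, 0)) ` {0..1} \<subseteq> {0..1} \<times> {0..1 :: real}"
    by (auto intro!: continuous_intros)
  ultimately have "develops (\<lambda>t. (\<gamma> \<circ> fst) (t, 0::real)) {0..1} (\<lambda>t. h (t, 0))"
    using develops_compose unfolding o_def by blast
  then show ?thesis by (intro that) (simp add: o_def)
qed

section \<open>Monodromy on simply connected spaces\<close>

text \<open>Develop a homotopy from the loop to a constant loop. The two edges traced by the
  endpoints carry the same path, hence have equal increments; the edge on the constant loop has
  increment 0. So the remaining edge, which carries the given loop, has increment 0 as well.\<close>

lemma develops_loop:
  assumes sc: "simply_connected (UNIV :: 'a set)" and "path \<gamma>" "\<gamma> 0 = \<gamma> 1" and h: "develops \<gamma> {0..1} h"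
  shows "h 0 = h 1"
proof -
  have "homotopic_loops UNIV \<gamma> (\<lambda>_. \<gamma> 0)"
    using sc assms unfolding simply_connected_def
    by (auto simp: pathfinish_def pathstart_def path_def)
  then obtain H where H: "continuous_on ({0..1::real} \<times> {0..1::real}) H"
      "\<And>x. x \<in> {0..1} \<Longrightarrow> H (0, x) = \<gamma> x" "\<And>x. x \<in> {0..1} \<Longrightarrow> H (1, x) = \<gamma> 0"
      "\<And>t. t \<in> {0..1} \<Longrightarrow> H (t, 1) = H (t, 0)"
    unfolding homotopic_loops pathfinish_def pathstart_def by auto
  obtain g where g: "develops H ({0..1} \<times> {0..1}) g"
    using develops_square_exists[OF H(1)] .
  have slice: "develops (H \<circ> r) {0..1} (g \<circ> r)" if "continuous_on {0..1} r" "r ` {0..1} \<subseteq> {0..1} \<times> {0..1}"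
    for r :: "real \<Rightarrow> _"
    using develops_compose[OF g that] .
  have conn: "connected {0..1::real}" by simp
  have "develops \<gamma> {0..1} (\<lambda>t. g (0, t))"
    by (rule develops_cong[OF slice[of "\<lambda>t. (0, t)"]]) (auto simp: H intro!: continuous_intros)
  from develops_unique[OF conn h this] have 1: "h 1 - g (0, 1) = h 0 - g (0, 0)"
    unfolding constant_on_def by force
  have "develops (\<lambda>t. H (t, 0)) {0..1} (\<lambda>t. g (t, 0))"
    by (rule develops_cong[OF slice[of "\<lambda>t. (t, 0)"]]) (auto intro!: continuous_intros)
  moreover have "develops (\<lambda>t. H (t, 0)) {0..1} (\<lambda>t. g (t, 1))"
    by (rule develops_cong[OF slice[of "\<lambda>t. (t, 1)"]]) (auto simp: H intro!: continuous_intros)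
  ultimately have 2: "g (0, 0) - g (0, 1) = g (1, 0) - g (1, 1)"
    using develops_unique[OF conn] unfolding constant_on_def by force
  have "develops (\<lambda>_. \<gamma> 0) {0..1::real} (\<lambda>t. g (1, t))"
    by (rule develops_cong[OF slice[of "\<lambda>t. (1, t)"]]) (auto simp: H intro!: continuous_intros)
  moreover have "develops (\<lambda>_. \<gamma> 0) {0..1::real} (\<lambda>_. 0)"
    by (simp add: develops_def diag)
  ultimately have 3: "g (1, 0) = g (1, 1)"
    using develops_unique[OF conn] unfolding constant_on_def by force
  show ?thesis using 1 2 3 by (simp add: algebra_simps)
qed

lemma develops_join:
  assumes "develops \<gamma> {0..1} h" "develops \<sigma> {0..1} g" "\<gamma> 1 = \<sigma> 0" "h 1 = g 0"
  shows "develops (\<gamma> +++ \<sigma>) {0..1} (\<lambda>t. if t \<le> 1/2 then h (2*t) else g (2*t - 1))" (is "develops _ _ ?f")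
proof -
  \<comment> \<open>Both closed halves contain 1/2, so there the two branches have to agree in path
    and in development.\<close>
  have mid: "\<gamma> (2 * t) = \<sigma> (2 * t - 1)" "h (2 * t) = g (2 * t - 1)" if "1/2 \<le> t" "t * 2 \<le> 1" for t
  proof -
    have "2 * t = 1" "2 * t - 1 = 0" using that by auto
    then show "\<gamma> (2 * t) = \<sigma> (2 * t - 1)" "h (2 * t) = g (2 * t - 1)"
      using assms(3,4) by (simp_all only:)
  qed
  have "develops (\<gamma> \<circ> (\<lambda>t. 2*t)) {0..1/2} (h \<circ> (\<lambda>t. 2*t))"
    by (rule develops_compose[OF assms(1)]) (auto intro!: continuous_intros)
  then have "develops (\<gamma> +++ \<sigma>) {0..1/2} ?f"
    by (rule develops_cong) (auto simp: joinpaths_def)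
  moreover have "develops (\<sigma> \<circ> (\<lambda>t. 2*t-1)) {1/2..1} (g \<circ> (\<lambda>t. 2*t-1))"
    by (rule develops_compose[OF assms(2)]) (auto intro!: continuous_intros)
  then have "develops (\<gamma> +++ \<sigma>) {1/2..1} ?f"
    by (rule develops_cong) (use mid in \<open>auto simp: joinpaths_def\<close>)
  moreover have "{0..1::real} = {0..1/2} \<union> {1/2..1}" by auto
  ultimately show ?thesis by (metis develops_Un closed_atLeastAtMost)
qed

lemma develops_same_ends:
  assumes sc: "simply_connected (UNIV :: 'a set)" and "path \<gamma>" "path \<sigma>" "\<gamma> 0 = \<sigma> 0" "\<gamma> 1 = \<sigma> 1"
    and h: "develops \<gamma> {0..1} h" and g: "develops \<sigma> {0..1} g"
  shows "h 1 - h 0 = g 1 - g 0"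
proof -
  \<comment> \<open>The shift makes the development of \<open>\<sigma>\<close>, read backwards,
    start at the value where \<open>h\<close> ends; the two then form a development of a
    loop.\<close>
  define g' where "g' = (\<lambda>t. g t + (h 1 - g 1))"
  have "develops (\<sigma> \<circ> (\<lambda>t. 1 - t)) {0..1} (g' \<circ> (\<lambda>t. 1 - t))"
    unfolding g'_def
    by (rule develops_compose[OF develops_add_const[OF g]]) (auto intro!: continuous_intros)
  then have "develops (reversepath \<sigma>) {0..1} (g' \<circ> (\<lambda>t. 1 - t))"
    by (simp add: reversepath_def o_def)
  then have "develops (\<gamma> +++ reversepath \<sigma>) {0..1}
      (\<lambda>t. if t \<le> 1/2 then h (2*t) else (g' \<circ> (\<lambda>t. 1 - t)) (2*t - 1))"
    by (rule develops_join[OF h]) (use assms in \<open>auto simp: reversepath_def g'_def\<close>)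
  from develops_loop[OF sc _ _ this] have "h 0 = g' 0"
    if "path (\<gamma> +++ reversepath \<sigma>)" "(\<gamma> +++ reversepath \<sigma>) 0 = (\<gamma> +++ reversepath \<sigma>) 1"
    using that by simp
  moreover have "path (\<gamma> +++ reversepath \<sigma>)"
    using assms by (intro path_join_imp) (auto simp: pathfinish_def)
  moreover have "(\<gamma> +++ reversepath \<sigma>) 0 = (\<gamma> +++ reversepath \<sigma>) 1"
    using assms by (simp add: joinpaths_def reversepath_def)
  ultimately have "h 0 = g' 0"
    by blast
  then show ?thesis by (simp add: g'_def algebra_simps)
qed

text \<open>The value of \<open>G\<close> at a point is the end value of a development along a path
  from a base point, and it does not depend on the path. Near \<open>x\<close> it may therefore be
  computed by prolonging the path to \<open>x\<close>.\<close>

theorem simply_connected_coboundary: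
  assumes sc: "simply_connected (UNIV :: 'a set)" and pc: "path_connected (UNIV :: 'a set)"
    and lpc: "\<And>(x::'a) N. open N \<Longrightarrow> x \<in> N \<Longrightarrow> \<exists>M. open M \<and> x \<in> M \<and> M \<subseteq> N \<and> path_connected M"
  obtains G where "\<And>x. \<forall>\<^sub>F y in nhds x. G y = G x + D x y"
proof -
  define x0 :: 'a where "x0 = undefined"
  have ex: "\<exists>\<gamma> h. path \<gamma> \<and> \<gamma> 0 = x0 \<and> \<gamma> 1 = z \<and> develops \<gamma> {0..1} h \<and> h 0 = 0" for z
  proof -
    obtain \<gamma> where \<gamma>: "path \<gamma>" "\<gamma> 0 = x0" "\<gamma> 1 = z"
      using pc unfolding path_connected_def pathstart_def pathfinish_def by blast
    obtain h where "develops \<gamma> {0..1} h" using develops_path_exists[OF \<gamma>(1)] .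
    from develops_add_const[OF this, of "- h 0"] \<gamma> show ?thesis by force
  qed
  then obtain \<gamma> h where gh: "\<And>z. path (\<gamma> z)" "\<And>z. \<gamma> z 0 = x0" "\<And>z. \<gamma> z 1 = z"
      "\<And>z. develops (\<gamma> z) {0..1} (h z)" "\<And>z. h z 0 = 0"
    by metis
  have "\<forall>\<^sub>F y in nhds x. h y 1 = h x 1 + D x y" for x
  proof -
    obtain N where N: "open N" "x \<in> N"
        "\<And>K (H :: real \<Rightarrow> 'a). continuous_on K H \<Longrightarrow> H ` K \<subseteq> N \<Longrightarrow> develops H K (\<lambda>k. D x (H k))"
      using develops_local by blast
    \<comment> \<open>The prolonging path must stay inside \<open>N\<close>, where
      \<open>D x\<close> is a development; local path connectedness provides it.\<close>
    obtain M where M: "open M" "x \<in> M" "M \<subseteq> N" "path_connected M" using lpc[OF N(1,2)] by blast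
    have "h y 1 = h x 1 + D x y" if y: "y \<in> M" for y
    proof -
      obtain \<sigma> where \<sigma>: "path \<sigma>" "path_image \<sigma> \<subseteq> M" "\<sigma> 0 = x" "\<sigma> 1 = y"
        using M(4)[unfolded path_connected_def, rule_format, OF M(2) y]
        by (auto simp: pathstart_def pathfinish_def)
      have loc: "develops \<sigma> {0..1} (\<lambda>t. D x (\<sigma> t))"
      proof (rule N(3))
        show "continuous_on {0..1} \<sigma>" using \<sigma>(1) by (simp add: path_def)
        show "\<sigma> ` {0..1} \<subseteq> N" using \<sigma>(2) M(3) unfolding path_image_def by (rule order_trans)
      qed
      have ends: "\<gamma> x 1 = \<sigma> 0" "h x 1 = D x (\<sigma> 0) + h x 1"
        by (simp_all add: \<sigma> gh diag)
      note join = develops_join[OF gh(4)[of x] develops_add_const[OF loc, of "h x 1"] ends]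
      have "path (\<gamma> x +++ \<sigma>)"
        using gh(1)[of x] \<sigma>(1) ends(1) by (simp add: pathfinish_def pathstart_def)
      moreover have "\<gamma> y 0 = (\<gamma> x +++ \<sigma>) 0" "\<gamma> y 1 = (\<gamma> x +++ \<sigma>) 1"
        by (simp_all add: joinpaths_def gh(2,3) \<sigma>(4))
      ultimately have "h y 1 - h y 0 = (D x (\<sigma> 1) + h x 1) - h x 0"
        using develops_same_ends[OF sc gh(1)[of y] _ _ _ gh(4) join] by simp
      then show ?thesis
        by (simp add: gh(5) \<sigma>(4) algebra_simps)
    qed
    then show ?thesis
      using M unfolding eventually_nhds by blast
  qed
  then show ?thesis by (rule that)
qed

end

section \<open>Primitives and path integrals on Riemann surfaces\<close>

text \<open>The derivatives involved are two-sided, and nothing is known about \<open>g\<close>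
  beyond the interval. So the endpoints are added to the finite exceptional set.\<close>

lemma piecewise_C1_differentiable_on_cong:
  fixes f g :: "real \<Rightarrow> 'a::real_normed_vector"
  assumes f: "f piecewise_C1_differentiable_on {a..b}" and eq: "\<And>t. t \<in> {a..b} \<Longrightarrow> g t = f t"
  shows "g piecewise_C1_differentiable_on {a..b}"
proof -
  obtain S D where S: "finite S" "continuous_on {a..b} f"
      "\<And>t. t \<in> {a..b} - S \<Longrightarrow> (f has_vector_derivative D t) (at t)" "continuous_on ({a..b} - S) D"
    using f unfolding piecewise_C1_differentiable_on_def C1_differentiable_on_def by blast
  have "(g has_vector_derivative D t) (at t)" if "t \<in> {a..b} - (S \<union> {a, b})" for t
  proof (rule has_vector_derivative_transform_within_open[where S = "{a<..<b}"])
    show "(f has_vector_derivative D t) (at t)" using S(3) that by auto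
  qed (use that eq in auto)
  moreover have "continuous_on ({a..b} - (S \<union> {a, b})) D"
    using S(4) by (rule continuous_on_subset) auto
  ultimately have C1: "g C1_differentiable_on {a..b} - (S \<union> {a, b})"
    unfolding C1_differentiable_on_def by blast
  have cont: "continuous_on {a..b} g"
    using S(2) eq by (metis continuous_on_cong)
  have "finite (S \<union> {a, b})" using S(1) by simp
  then show ?thesis
    unfolding piecewise_C1_differentiable_on_def
    by (intro conjI exI[of _ "S \<union> {a, b}"] cont C1)
qed

lemma has_field_derivative_eventually_cong:
  assumes "(f has_field_derivative D) (at x)" "\<forall>\<^sub>F y in nhds x. f y = g y"
  shows "(g has_field_derivative D) (at x)"
  using assms(1) iffD1[OF DERIV_cong_ev[OF refl assms(2) refl]] by blast

lemma isCont_nhds: "isCont f x \<Longrightarrow> filterlim f (nhds (f x)) (nhds x)"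
  unfolding isCont_def tendsto_at_iff_tendsto_nhds .

locale surface =
  fixes \<A> :: "'a::t2_space chart set"
  assumes riemann_surface: "riemann_surface \<A>"
begin

section \<open>Charts and changes of coordinates\<close>

lemma chart_at:
  obtains U \<phi> where "(U, \<phi>) \<in> \<A>" "z \<in> U"
proof -
  have "z \<in> (\<Union>(U, \<phi>) \<in> \<A>. U)"
    using riemann_surface unfolding riemann_surface_def by simp
  then show ?thesis using that by blast
qed

lemma
  assumes "(U, \<phi>) \<in> \<A>"
  shows chart_open: "open U" and chart_open_image: "open (\<phi> ` U)"
    and chart_continuous: "continuous_on U \<phi>"
    and chart_inv_continuous: "continuous_on (\<phi> ` U) (inv_into U \<phi>)"
    and chart_inv: "z \<in> U \<Longrightarrow> inv_into U \<phi> (\<phi> z) = z"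
proof -
  have "\<forall>(U, \<phi>) \<in> \<A>. open U \<and> open (\<phi> ` U) \<and> homeomorphism U (\<phi> ` U) \<phi> (inv_into U \<phi>)"
    using riemann_surface unfolding riemann_surface_def by simp
  from bspec[OF this assms]
  show "open U" "open (\<phi> ` U)" "continuous_on U \<phi>" "continuous_on (\<phi> ` U) (inv_into U \<phi>)"
    "z \<in> U \<Longrightarrow> inv_into U \<phi> (\<phi> z) = z"
    by (simp_all add: homeomorphism_def)
qed

lemma chart_lim:
  assumes "(U, \<phi>) \<in> \<A>" "z \<in> U"
  shows "filterlim \<phi> (nhds (\<phi> z)) (nhds z)"
proof (rule isCont_nhds)
  show "isCont \<phi> z"
    using chart_continuous[OF assms(1)] chart_open[OF assms(1)] assms(2)
    by (simp add: continuous_on_eq_continuous_at)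
qed

lemma chart_inv_lim:
  assumes "(U, \<phi>) \<in> \<A>" "z \<in> U"
  shows "filterlim (inv_into U \<phi>) (nhds z) (nhds (\<phi> z))"
proof -
  have "isCont (inv_into U \<phi>) (\<phi> z)"
    using chart_inv_continuous[OF assms(1)] chart_open_image[OF assms(1)] assms(2)
    by (simp add: continuous_on_eq_continuous_at)
  from isCont_nhds[OF this] show ?thesis
    by (simp add: chart_inv[OF assms])
qed

lemma eventually_in_chart:
  assumes "(U, \<phi>) \<in> \<A>" "z \<in> U"
  shows "\<forall>\<^sub>F y in nhds z. y \<in> U"
  using chart_open[OF assms(1)] assms(2) by (rule eventually_nhds_in_open)

lemma eventually_coord:
  assumes "(U, \<phi>) \<in> \<A>" "z \<in> U" "\<forall>\<^sub>F y in nhds z. P y"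
  shows "\<forall>\<^sub>F w in nhds (\<phi> z). P (inv_into U \<phi> w)"
  using eventually_compose_filterlim[OF assms(3) chart_inv_lim[OF assms(1,2)]] .

lemma chart_open_image_sub:
  assumes "(U, \<phi>) \<in> \<A>" "open W" "W \<subseteq> U"
  shows "open (\<phi> ` W)"
proof -
  have "\<phi> ` W = \<phi> ` U \<inter> inv_into U \<phi> -` W"
    using assms(3) chart_inv[OF assms(1)] by force
  then show ?thesis
    using continuous_open_preimage[OF chart_inv_continuous[OF assms(1)] chart_open_image[OF assms(1)] assms(2)]
    by simp
qed

lemma transition_holomorphic:
  assumes "(U, \<phi>) \<in> \<A>" "(V, \<psi>) \<in> \<A>"
  shows "(\<psi> \<circ> inv_into U \<phi>) holomorphic_on \<phi> ` (U \<inter> V)"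
proof -
  have "\<forall>(U, \<phi>) \<in> \<A>. \<forall>(V, \<psi>) \<in> \<A>. (\<psi> \<circ> inv_into U \<phi>) holomorphic_on \<phi> ` (U \<inter> V)"
    using riemann_surface unfolding riemann_surface_def by simp
  from bspec[OF this assms(1)] assms(2) show ?thesis by auto
qed

lemma transition_open:
  assumes "(U, \<phi>) \<in> \<A>" "(V, \<psi>) \<in> \<A>"
  shows "open (\<phi> ` (U \<inter> V))"
  by (intro chart_open_image_sub[OF assms(1)] open_Int chart_open[OF assms(1)] chart_open[OF assms(2)]) auto

lemma transition_deriv:
  assumes "(U, \<phi>) \<in> \<A>" "(V, \<psi>) \<in> \<A>" "z \<in> U \<inter> V"
  shows "((\<psi> \<circ> inv_into U \<phi>) has_field_derivative deriv (\<psi> \<circ> inv_into U \<phi>) (\<phi> z)) (at (\<phi> z))"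
  by (rule holomorphic_derivI[OF transition_holomorphic transition_open, OF assms(1,2) assms(1,2)])
    (use assms(3) in auto)

text \<open>Chain rule for the transition map. Its factor is the one in the transformation rule of
  \<open>holo_forms\<close>, so differentials of functions and local primitives of forms can be
  moved between charts.\<close>

lemma has_field_derivative_change_chart:
  assumes UV: "(U, \<phi>) \<in> \<A>" "(V, \<psi>) \<in> \<A>" "z \<in> U \<inter> V"
    and f: "((f \<circ> inv_into V \<psi>) has_field_derivative D) (at (\<psi> z))"
  shows "((f \<circ> inv_into U \<phi>) has_field_derivative D * deriv (\<psi> \<circ> inv_into U \<phi>) (\<phi> z)) (at (\<phi> z))"
proof -
  have inv: "inv_into U \<phi> (\<phi> z) = z"
    using chart_inv UV by auto
  have "((f \<circ> inv_into V \<psi> \<circ> (\<psi> \<circ> inv_into U \<phi>)) has_field_derivative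
      D * deriv (\<psi> \<circ> inv_into U \<phi>) (\<phi> z)) (at (\<phi> z))"
    by (rule DERIV_chain[OF _ transition_deriv[OF UV]]) (use f inv in simp)
  moreover have "\<forall>\<^sub>F w in nhds (\<phi> z). inv_into U \<phi> w \<in> V"
    using eventually_coord[OF UV(1)] eventually_in_chart[OF UV(2)] UV(3) by blast
  then have "\<forall>\<^sub>F w in nhds (\<phi> z). (f \<circ> inv_into V \<psi> \<circ> (\<psi> \<circ> inv_into U \<phi>)) w = (f \<circ> inv_into U \<phi>) w"
    by eventually_elim (simp add: chart_inv[OF UV(2)])
  ultimately show ?thesis
    by (rule has_field_derivative_eventually_cong)
qed

section \<open>Holomorphic functions and forms in charts\<close>

lemma holo_functions_chart:
  assumes "f \<in> holo_functions \<A>" "(U, \<phi>) \<in> \<A>"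
  shows "(f \<circ> inv_into U \<phi>) holomorphic_on \<phi> ` U"
proof -
  have "\<forall>(U, \<phi>) \<in> \<A>. (f \<circ> inv_into U \<phi>) holomorphic_on \<phi> ` U"
    using assms(1) by (simp add: holo_functions_def)
  from bspec[OF this assms(2)] show ?thesis by simp
qed

lemma holo_has_field_derivative:
  assumes "f \<in> holo_functions \<A>" "(U, \<phi>) \<in> \<A>" "z \<in> U"
  shows "((f \<circ> inv_into U \<phi>) has_field_derivative ext_deriv \<A> f (U, \<phi>) z) (at (\<phi> z))"
proof -
  have "(f \<circ> inv_into U \<phi>) holomorphic_on \<phi> ` U"
    using assms by (intro holo_functions_chart)
  then have "((f \<circ> inv_into U \<phi>) has_field_derivative deriv (f \<circ> inv_into U \<phi>) (\<phi> z)) (at (\<phi> z))"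
    by (rule holomorphic_derivI[OF _ chart_open_image]) (use assms in auto)
  then show ?thesis using assms by (simp add: ext_deriv_def)
qed

lemma ext_deriv_eqI:
  assumes "(U, \<phi>) \<in> \<A>" "z \<in> U" "((f \<circ> inv_into U \<phi>) has_field_derivative D) (at (\<phi> z))"
  shows "ext_deriv \<A> f (U, \<phi>) z = D"
  using assms by (simp add: ext_deriv_def DERIV_imp_deriv)

lemma ext_deriv_outside: "c \<notin> \<A> \<or> z \<notin> fst c \<Longrightarrow> ext_deriv \<A> f c z = 0"
  by (auto simp: ext_deriv_def split: prod.splits)

lemma holo_functionsI:
  assumes "\<And>U \<phi> z. (U, \<phi>) \<in> \<A> \<Longrightarrow> z \<in> U \<Longrightarrow> ((f \<circ> inv_into U \<phi>) has_field_derivative D U \<phi> z) (at (\<phi> z))"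
  shows "f \<in> holo_functions \<A>"
proof -
  have "(f \<circ> inv_into U \<phi>) holomorphic_on \<phi> ` U" if U: "(U, \<phi>) \<in> \<A>" for U \<phi>
    unfolding holomorphic_on_open[OF chart_open_image[OF U]] using assms[OF U] by auto
  then show ?thesis
    unfolding holo_functions_def by auto
qed

lemma holo_const: "(\<lambda>_. c) \<in> holo_functions \<A>"
  by (rule holo_functionsI[where D = "\<lambda>_ _ _. 0"]) (simp add: o_def)

lemma holo_continuous:
  assumes "f \<in> holo_functions \<A>"
  shows "continuous_on UNIV f"
proof -
  have "isCont f z" for z
  proof -
    obtain U \<phi> where U: "(U, \<phi>) \<in> \<A>" "z \<in> U" by (rule chart_at)
    have "isCont (f \<circ> inv_into U \<phi>) (\<phi> z)"
      using DERIV_isCont[OF holo_has_field_derivative[OF assms U]] .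
    from isCont_nhds[OF this] have "filterlim (f \<circ> inv_into U \<phi>) (nhds (f z)) (nhds (\<phi> z))"
      by (simp add: chart_inv[OF U])
    from filterlim_compose[OF this chart_lim[OF U]]
    have "filterlim (\<lambda>y. f (inv_into U \<phi> (\<phi> y))) (nhds (f z)) (nhds z)" by (simp add: o_def)
    moreover have "\<forall>\<^sub>F y in nhds z. f (inv_into U \<phi> (\<phi> y)) = f y"
      using eventually_in_chart[OF U] by eventually_elim (simp add: chart_inv[OF U(1)])
    ultimately have "filterlim f (nhds (f z)) (nhds z)"
      using filterlim_cong by fast
    then show ?thesis by (simp add: isCont_def tendsto_at_iff_tendsto_nhds)
  qed
  then show ?thesis by (simp add: continuous_at_imp_continuous_on)
qed

lemma holo_forms_holomorphic:
  assumes "\<omega> \<in> holo_forms \<A>" "(U, \<phi>) \<in> \<A>"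
  shows "(\<omega> (U, \<phi>) \<circ> inv_into U \<phi>) holomorphic_on \<phi> ` U"
proof -
  have "\<forall>(U, \<phi>) \<in> \<A>. (\<omega> (U, \<phi>) \<circ> inv_into U \<phi>) holomorphic_on \<phi> ` U"
    using assms(1) by (simp add: holo_forms_def)
  from bspec[OF this assms(2)] show ?thesis by simp
qed

lemma holo_forms_transition:
  assumes "\<omega> \<in> holo_forms \<A>" "(U, \<phi>) \<in> \<A>" "(V, \<psi>) \<in> \<A>" "z \<in> U" "z \<in> V"
  shows "\<omega> (U, \<phi>) z = \<omega> (V, \<psi>) z * deriv (\<psi> \<circ> inv_into U \<phi>) (\<phi> z)"
proof -
  have "\<forall>(U, \<phi>) \<in> \<A>. \<forall>(V, \<psi>) \<in> \<A>. \<forall>z \<in> U \<inter> V.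
      \<omega> (U, \<phi>) z = \<omega> (V, \<psi>) z * deriv (\<psi> \<circ> inv_into U \<phi>) (\<phi> z)"
    using assms(1) unfolding holo_forms_def by (elim CollectE conjE)
  from bspec[OF this assms(2), unfolded split, THEN bspec, OF assms(3)] assms(4,5) show ?thesis by simp
qed

lemma holo_forms_outside: "\<omega> \<in> holo_forms \<A> \<Longrightarrow> c \<notin> \<A> \<or> z \<notin> fst c \<Longrightarrow> \<omega> c z = 0"
  unfolding holo_forms_def by (elim CollectE conjE) blast

lemma holo_formsI:
  assumes hol: "\<And>U \<phi>. (U, \<phi>) \<in> \<A> \<Longrightarrow> (\<omega> (U, \<phi>) \<circ> inv_into U \<phi>) holomorphic_on \<phi> ` U"
    and tr: "\<And>U \<phi> V \<psi> z. (U, \<phi>) \<in> \<A> \<Longrightarrow> (V, \<psi>) \<in> \<A> \<Longrightarrow> z \<in> U \<Longrightarrow> z \<in> V \<Longrightarrow>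
      \<omega> (U, \<phi>) z = \<omega> (V, \<psi>) z * deriv (\<psi> \<circ> inv_into U \<phi>) (\<phi> z)"
    and outside: "\<And>c z. c \<notin> \<A> \<or> z \<notin> fst c \<Longrightarrow> \<omega> c z = 0"
  shows "\<omega> \<in> holo_forms \<A>"
  unfolding holo_forms_def
proof (intro CollectI conjI)
  show "\<forall>(U, \<phi>) \<in> \<A>. (\<omega> (U, \<phi>) \<circ> inv_into U \<phi>) holomorphic_on \<phi> ` U"
    using hol by auto
  show "\<forall>(U, \<phi>) \<in> \<A>. \<forall>(V, \<psi>) \<in> \<A>. \<forall>z \<in> U \<inter> V.
      \<omega> (U, \<phi>) z = \<omega> (V, \<psi>) z * deriv (\<psi> \<circ> inv_into U \<phi>) (\<phi> z)"
    by (clarify, rule tr) auto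
  show "\<forall>c z. c \<notin> \<A> \<or> z \<notin> fst c \<longrightarrow> \<omega> c z = 0"
    using outside by blast
qed

lemma ext_deriv_holo_forms:
  assumes f: "f \<in> holo_functions \<A>"
  shows "ext_deriv \<A> f \<in> holo_forms \<A>"
proof (rule holo_formsI)
  fix U \<phi> assume U: "(U, \<phi>) \<in> \<A>"
  have "deriv (f \<circ> inv_into U \<phi>) holomorphic_on \<phi> ` U"
    by (intro holomorphic_deriv chart_open_image[OF U] holo_functions_chart f U)
  then show "(ext_deriv \<A> f (U, \<phi>) \<circ> inv_into U \<phi>) holomorphic_on \<phi> ` U"
    by (rule holomorphic_transform) (use U in \<open>auto simp: chart_inv ext_deriv_def\<close>)
next
  fix U \<phi> V \<psi> z assume "(U, \<phi>) \<in> \<A>" "(V, \<psi>) \<in> \<A>" "z \<in> U" "z \<in> V"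
  then have UV: "(U, \<phi>) \<in> \<A>" "(V, \<psi>) \<in> \<A>" "z \<in> U \<inter> V" and z: "z \<in> U" "z \<in> V" by auto
  show "ext_deriv \<A> f (U, \<phi>) z = ext_deriv \<A> f (V, \<psi>) z * deriv (\<psi> \<circ> inv_into U \<phi>) (\<phi> z)"
    by (rule ext_deriv_eqI[OF UV(1) z(1) has_field_derivative_change_chart[OF UV
          holo_has_field_derivative[OF f UV(2) z(2)]]])
qed (rule ext_deriv_outside)

section \<open>Coordinate discs and local primitives\<close>

text \<open>Supplies arbitrarily small neighbourhoods whose coordinate image is convex, as needed
  for local paths, for primitives and for their uniqueness.\<close>

lemma coordinate_ball:
  assumes "(U, \<phi>) \<in> \<A>" "z \<in> U" "open N" "z \<in> N"
  obtains r M where "r > 0" "ball (\<phi> z) r \<subseteq> \<phi> ` (U \<inter> N)" "M = inv_into U \<phi> ` ball (\<phi> z) r"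
    "open M" "z \<in> M" "M \<subseteq> U \<inter> N" "\<phi> ` M = ball (\<phi> z) r"
proof -
  have "open (\<phi> ` (U \<inter> N))"
    by (intro chart_open_image_sub[OF assms(1)] open_Int chart_open[OF assms(1)] assms(3)) simp
  moreover have "\<phi> z \<in> \<phi> ` (U \<inter> N)" using assms by blast
  ultimately obtain r where r: "r > 0" "ball (\<phi> z) r \<subseteq> \<phi> ` (U \<inter> N)"
    using open_contains_ball by metis
  define M where "M = inv_into U \<phi> ` ball (\<phi> z) r"
  have im: "inv_into U \<phi> w \<in> U \<inter> N" "\<phi> (inv_into U \<phi> w) = w" if w: "w \<in> ball (\<phi> z) r" for w
  proof -
    obtain y where "y \<in> U \<inter> N" "w = \<phi> y" using r(2) w by blast
    then show "inv_into U \<phi> w \<in> U \<inter> N" "\<phi> (inv_into U \<phi> w) = w"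
      using chart_inv[OF assms(1), of y] by auto
  qed
  \<comment> \<open>Written as a preimage under the continuous coordinate, \<open>M\<close> is seen
    to be open.\<close>
  have "M = U \<inter> \<phi> -` ball (\<phi> z) r"
  proof
    show "M \<subseteq> U \<inter> \<phi> -` ball (\<phi> z) r" using im unfolding M_def by auto
    show "U \<inter> \<phi> -` ball (\<phi> z) r \<subseteq> M"
    proof
      fix y assume y: "y \<in> U \<inter> \<phi> -` ball (\<phi> z) r"
      then have "y = inv_into U \<phi> (\<phi> y)" using chart_inv[OF assms(1)] by simp
      then show "y \<in> M" unfolding M_def using y by blast
    qed
  qed
  then have "open M"
    using continuous_open_preimage[OF chart_continuous[OF assms(1)] chart_open[OF assms(1)] open_ball] by simp
  moreover have "z \<in> M"
    unfolding M_def using r(1) chart_inv[OF assms(1,2)] by (metis centre_in_ball imageI)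
  moreover have "M \<subseteq> U \<inter> N"
    using im(1) unfolding M_def by blast
  moreover have "\<phi> ` M = ball (\<phi> z) r"
    unfolding M_def image_image using im(2) by simp
  ultimately show ?thesis using that[OF r M_def] by blast
qed

lemma locally_path_connected_surface:
  fixes z :: 'a
  assumes "open N" "z \<in> N"
  shows "\<exists>M. open M \<and> z \<in> M \<and> M \<subseteq> N \<and> path_connected M"
proof -
  obtain U \<phi> where U: "(U, \<phi>) \<in> \<A>" "z \<in> U" by (rule chart_at)
  obtain r M where M: "ball (\<phi> z) r \<subseteq> \<phi> ` (U \<inter> N)" "M = inv_into U \<phi> ` ball (\<phi> z) r"
    "open M" "z \<in> M" "M \<subseteq> U \<inter> N"
    by (rule coordinate_ball[OF U assms])
  have "continuous_on (ball (\<phi> z) r) (inv_into U \<phi>)"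
    using chart_inv_continuous[OF U(1)] by (rule continuous_on_subset) (use M in blast)
  then have "path_connected M"
    unfolding M(2) by (rule path_connected_continuous_image) (simp add: convex_imp_path_connected)
  then show ?thesis using M by blast
qed

text \<open>The condition is imposed in all charts meeting \<open>W\<close>, so that two primitives
  found in different charts can be compared in any third one.\<close>

definition local_primitive :: "'a form \<Rightarrow> ('a \<Rightarrow> complex) \<Rightarrow> 'a set \<Rightarrow> bool" where
  "local_primitive \<omega> F W \<longleftrightarrow> open W \<and> (\<forall>(U, \<phi>) \<in> \<A>. \<forall>z \<in> U \<inter> W.
     ((F \<circ> inv_into U \<phi>) has_field_derivative \<omega> (U, \<phi>) z) (at (\<phi> z)))"

text \<open>A holomorphic function on a disc has a primitive. Carried to another chart, it stays a
  primitive because the chain rule factor matches the transformation rule of the form.\<close>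

lemma local_primitive_exists:
  assumes \<omega>: "\<omega> \<in> holo_forms \<A>"
  shows "\<exists>F W. z \<in> W \<and> local_primitive \<omega> F W"
proof -
  obtain U \<phi> where U: "(U, \<phi>) \<in> \<A>" "z \<in> U" by (rule chart_at)
  obtain r M where M: "ball (\<phi> z) r \<subseteq> \<phi> ` (U \<inter> UNIV)" "M = inv_into U \<phi> ` ball (\<phi> z) r"
    "open M" "z \<in> M" "M \<subseteq> U \<inter> UNIV" "\<phi> ` M = ball (\<phi> z) r"
    by (rule coordinate_ball[OF U open_UNIV UNIV_I])
  have "(\<omega> (U, \<phi>) \<circ> inv_into U \<phi>) holomorphic_on \<phi> ` U"
    using \<omega> U(1) by (rule holo_forms_holomorphic)
  then have "(\<omega> (U, \<phi>) \<circ> inv_into U \<phi>) holomorphic_on ball (\<phi> z) r"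
    by (rule holomorphic_on_subset) (use M in auto)
  then obtain f where f: "\<And>w. w \<in> ball (\<phi> z) r \<Longrightarrow>
      (f has_field_derivative (\<omega> (U, \<phi>) \<circ> inv_into U \<phi>) w) (at w within ball (\<phi> z) r)"
    using holomorphic_convex_primitive'[OF convex_ball open_ball] by blast
  have "((f \<circ> \<phi> \<circ> inv_into V \<psi>) has_field_derivative \<omega> (V, \<psi>) y) (at (\<psi> y))"
    if V: "(V, \<psi>) \<in> \<A>" and y: "y \<in> V \<inter> M" for V \<psi> y
  proof -
    have yU: "y \<in> U" using y M by auto
    have "\<phi> y \<in> ball (\<phi> z) r" using y M(6) by auto
    then have "(f has_field_derivative \<omega> (U, \<phi>) y) (at (\<phi> y))"
      using f[of "\<phi> y"] chart_inv[OF U(1) yU] at_within_open[OF _ open_ball] by fastforce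
    moreover have "inv_into V \<psi> (\<psi> y) = y" using chart_inv[OF V] y by auto
    ultimately have "((f \<circ> (\<phi> \<circ> inv_into V \<psi>)) has_field_derivative
        \<omega> (U, \<phi>) y * deriv (\<phi> \<circ> inv_into V \<psi>) (\<psi> y)) (at (\<psi> y))"
      using yU y by (intro DERIV_chain transition_deriv[OF V U(1)]) auto
    moreover have "\<omega> (V, \<psi>) y = \<omega> (U, \<phi>) y * deriv (\<phi> \<circ> inv_into V \<psi>) (\<psi> y)"
      using y yU by (intro holo_forms_transition[OF \<omega> V U(1)]) auto
    ultimately show ?thesis by (simp add: comp_assoc)
  qed
  then have "local_primitive \<omega> (f \<circ> \<phi>) M"
    using M(3) unfolding local_primitive_def by auto
  with M(4) show ?thesis by blast
qed

text \<open>In a coordinate disc the difference has derivative 0, and a disc is convex.\<close>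

lemma local_primitive_unique:
  assumes F: "local_primitive \<omega> F W" "local_primitive \<omega> F' W'" and z: "z \<in> W" "z \<in> W'"
  shows "\<forall>\<^sub>F y in nhds z. F y - F z = F' y - F' z"
proof -
  obtain U \<phi> where U: "(U, \<phi>) \<in> \<A>" "z \<in> U" by (rule chart_at)
  have W: "open (W \<inter> W')" "z \<in> W \<inter> W'" using assms by (auto simp: local_primitive_def)
  obtain r M where M: "r > 0" "ball (\<phi> z) r \<subseteq> \<phi> ` (U \<inter> (W \<inter> W'))" "M = inv_into U \<phi> ` ball (\<phi> z) r"
    "open M" "z \<in> M" "M \<subseteq> U \<inter> (W \<inter> W')" "\<phi> ` M = ball (\<phi> z) r"
    by (rule coordinate_ball[OF U W])
  have "((\<lambda>w. (F \<circ> inv_into U \<phi>) w - (F' \<circ> inv_into U \<phi>) w) has_field_derivative 0) (at w within ball (\<phi> z) r)"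
    if w: "w \<in> ball (\<phi> z) r" for w
  proof -
    obtain y where y: "w = \<phi> y" "y \<in> U \<inter> (W \<inter> W')" using M(2) w by blast
    have "((F \<circ> inv_into U \<phi>) has_field_derivative \<omega> (U, \<phi>) y) (at w)"
      "((F' \<circ> inv_into U \<phi>) has_field_derivative \<omega> (U, \<phi>) y) (at w)"
      using F U y unfolding local_primitive_def by fast+
    from has_field_derivative_at_within[OF DERIV_diff[OF this]] show ?thesis by simp
  qed
  from has_field_derivative_zero_constant[OF convex_ball this]
  obtain c where c: "\<And>w. w \<in> ball (\<phi> z) r \<Longrightarrow> F (inv_into U \<phi> w) - F' (inv_into U \<phi> w) = c"
    by auto
  have *: "F y - F' y = c" if "y \<in> M" for y
  proof -
    have "\<phi> y \<in> ball (\<phi> z) r" using M(7) that by auto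
    moreover have "inv_into U \<phi> (\<phi> y) = y" using chart_inv[OF U(1)] M(6) that by blast
    ultimately show ?thesis using c[of "\<phi> y"] by simp
  qed
  have "\<forall>\<^sub>F y in nhds z. y \<in> M" using M(4,5) by (rule eventually_nhds_in_open)
  then show ?thesis
    by eventually_elim (use *[OF M(5)] * in \<open>auto simp: algebra_simps\<close>)
qed

section \<open>Piecewise C1 paths\<close>

text \<open>The definition tests a path in every chart it passes through. There the coordinate of a
  straight segment is a transition map composed with the segment, hence C1.\<close>

lemma piecewise_C1_path_line:
  assumes U: "(U, \<phi>) \<in> \<A>" and seg: "closed_segment v w \<subseteq> \<phi> ` U"
  shows "piecewise_C1_path \<A> (inv_into U \<phi> \<circ> linepath v w)"
proof -
  have "path (inv_into U \<phi> \<circ> linepath v w)"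
    using chart_inv_continuous[OF U] seg
    by (intro path_continuous_image) (auto intro: continuous_on_subset)
  moreover have "(\<psi> \<circ> (inv_into U \<phi> \<circ> linepath v w)) piecewise_C1_differentiable_on {a..b}"
    if V: "(V, \<psi>) \<in> \<A>" and ab: "0 \<le> a" "b \<le> 1" and im: "(inv_into U \<phi> \<circ> linepath v w) ` {a..b} \<subseteq> V"
    for V \<psi> a b
  proof -
    have mem: "linepath v w t \<in> \<phi> ` (U \<inter> V)" if "t \<in> {a..b}" for t
    proof -
      have "linepath v w t \<in> closed_segment v w"
        using that ab by (auto simp: linepath_in_path)
      then obtain y where y: "y \<in> U" "linepath v w t = \<phi> y" using seg by blast
      then have "y \<in> V" using im that chart_inv[OF U] by (metis comp_apply image_subset_iff)
      with y show ?thesis by blast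
    qed
    have lp: "((\<psi> \<circ> inv_into U \<phi> \<circ> linepath v w) has_vector_derivative
        (w - v) * deriv (\<psi> \<circ> inv_into U \<phi>) (linepath v w t)) (at t)" if "t \<in> {a..b}" for t
      by (rule field_vector_diff_chain_at[OF has_vector_derivative_linepath_within
            holomorphic_derivI[OF transition_holomorphic[OF U V] transition_open[OF U V] mem[OF that]]])
    have lc: "continuous_on {a..b} (\<lambda>t. (w - v) * deriv (\<psi> \<circ> inv_into U \<phi>) (linepath v w t))"
    proof -
      have cd: "continuous_on (\<phi> ` (U \<inter> V)) (deriv (\<psi> \<circ> inv_into U \<phi>))"
        by (intro holomorphic_on_imp_continuous_on holomorphic_deriv transition_holomorphic[OF U V] transition_open[OF U V])
      show ?thesis
        by (intro continuous_on_mult continuous_on_const continuous_on_compose2[OF cd continuous_on_linepath])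
          (rule image_subsetI, rule mem)
    qed
    have "(\<psi> \<circ> inv_into U \<phi> \<circ> linepath v w) C1_differentiable_on {a..b}"
      unfolding C1_differentiable_on_def
      by (rule exI[where x = "\<lambda>t. (w - v) * deriv (\<psi> \<circ> inv_into U \<phi>) (linepath v w t)"])
        (intro conjI ballI lp lc)
    from C1_differentiable_imp_piecewise[OF this] show ?thesis
      by (simp add: comp_assoc)
  qed
  ultimately show ?thesis
    unfolding piecewise_C1_path_def by auto
qed

lemma piecewise_C1_path_chart:
  assumes "piecewise_C1_path \<A> \<gamma>" "(U, \<phi>) \<in> \<A>" "0 \<le> a" "a \<le> b" "b \<le> 1" "\<gamma> ` {a..b} \<subseteq> U"
  shows "(\<phi> \<circ> \<gamma>) piecewise_C1_differentiable_on {a..b}"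
proof -
  have "\<forall>(U, \<phi>) \<in> \<A>. \<forall>a b. 0 \<le> a \<and> a \<le> b \<and> b \<le> 1 \<and> \<gamma> ` {a..b} \<subseteq> U \<longrightarrow>
      (\<phi> \<circ> \<gamma>) piecewise_C1_differentiable_on {a..b}"
    using assms(1) unfolding piecewise_C1_path_def by (rule conjunct2)
  from bspec[OF this assms(2)] show ?thesis using assms(3-) by simp
qed

lemma piecewise_C1_path_join:
  assumes \<gamma>: "piecewise_C1_path \<A> \<gamma>" and \<sigma>: "piecewise_C1_path \<A> \<sigma>" and eq: "\<gamma> 1 = \<sigma> 0"
  shows "piecewise_C1_path \<A> (\<gamma> +++ \<sigma>)"
proof -
  have "path (\<gamma> +++ \<sigma>)"
    using assms by (auto simp: piecewise_C1_path_def pathfinish_def pathstart_def)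
  moreover have "(\<phi> \<circ> (\<gamma> +++ \<sigma>)) piecewise_C1_differentiable_on {a..b}"
    if U: "(U, \<phi>) \<in> \<A>" and ab: "0 \<le> a" "a \<le> b" "b \<le> 1" and im: "(\<gamma> +++ \<sigma>) ` {a..b} \<subseteq> U" for U \<phi> a b
  proof -
    have first: "(\<lambda>t. \<phi> (\<gamma> (2*t))) piecewise_C1_differentiable_on {a..c}"
      if c: "a \<le> c" "c \<le> b" "c \<le> 1/2" for c
    proof -
      have "\<gamma> ` {2*a..2*c} \<subseteq> U"
      proof
        fix y assume "y \<in> \<gamma> ` {2*a..2*c}"
        then obtain t where t: "t \<in> {2*a..2*c}" "y = \<gamma> t" by blast
        then have "(\<gamma> +++ \<sigma>) (t/2) \<in> U" "t/2 \<le> 1/2" using c im by (auto simp: image_subset_iff)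
        then show "y \<in> U" using t by (simp add: joinpaths_def)
      qed
      then have "(\<phi> \<circ> \<gamma>) piecewise_C1_differentiable_on {2*a..2*c}"
        using ab c by (intro piecewise_C1_path_chart[OF \<gamma> U]) auto
      moreover have "(\<lambda>t. 2 * t + 0) ` {a..c} \<subseteq> {2*a..2*c}" by auto
      ultimately have "(\<phi> \<circ> \<gamma> \<circ> (\<lambda>t. 2 *\<^sub>R t + 0)) piecewise_C1_differentiable_on {a..c}"
        by (intro piecewise_C1_differentiable_affine) (rule piecewise_C1_differentiable_on_subset)
      then show ?thesis by (simp add: o_def)
    qed
    have second: "(\<lambda>t. \<phi> (\<sigma> (2*t-1))) piecewise_C1_differentiable_on {c..b}"
      if c: "a \<le> c" "c \<le> b" "1/2 \<le> c" for c
    proof -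
      have "\<sigma> ` {2*c-1..2*b-1} \<subseteq> U"
      proof
        fix y assume "y \<in> \<sigma> ` {2*c-1..2*b-1}"
        then obtain t where t: "t \<in> {2*c-1..2*b-1}" "y = \<sigma> t" by blast
        then have "(\<gamma> +++ \<sigma>) ((t+1)/2) \<in> U" using c im by (auto simp: image_subset_iff)
        moreover have "(\<gamma> +++ \<sigma>) ((t+1)/2) = y"
        \<comment> \<open>At \<open>t = 0\<close> the joined path is evaluated at 1/2 and takes its
          value from the first path; the matching endpoint \<open>eq\<close> is what makes this the
          start of the second.\<close>
        proof (cases "t = 0")
          case True then show ?thesis using t eq by (simp add: joinpaths_def)
        next
          case False
          then have "\<not> (t + 1) / 2 \<le> 1 / 2" using t c by auto
          moreover have "2 * ((t + 1) / 2) - 1 = t" by (simp add: field_simps)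
          ultimately show ?thesis using t(2) unfolding joinpaths_def by (simp only: if_False)
        qed
        ultimately show "y \<in> U" by simp
      qed
      then have "(\<phi> \<circ> \<sigma>) piecewise_C1_differentiable_on {2*c-1..2*b-1}"
        using ab c by (intro piecewise_C1_path_chart[OF \<sigma> U]) auto
      moreover have "(\<lambda>t. 2 * t + (-1)) ` {c..b} \<subseteq> {2*c-1..2*b-1}" by auto
      ultimately have "(\<phi> \<circ> \<sigma> \<circ> (\<lambda>t. 2 *\<^sub>R t + (-1))) piecewise_C1_differentiable_on {c..b}"
        by (intro piecewise_C1_differentiable_affine) (rule piecewise_C1_differentiable_on_subset)
      then show ?thesis by (simp add: o_def)
    qed
    \<comment> \<open>The join uses the first path at 1/2, hence the strict inequality in the second
      case.\<close>
    consider "b \<le> 1/2" | "a > 1/2" | "a \<le> 1/2" "1/2 \<le> b" by linarith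
    then show ?thesis
    proof cases
      case 1
      then have "(\<lambda>t. \<phi> (\<gamma> (2*t))) piecewise_C1_differentiable_on {a..b}"
        using first[of b] ab by simp
      then show ?thesis
        by (rule piecewise_C1_differentiable_on_cong) (use 1 in \<open>auto simp: joinpaths_def\<close>)
    next
      case 2
      then have "(\<lambda>t. \<phi> (\<sigma> (2*t-1))) piecewise_C1_differentiable_on {a..b}"
        using second[of a] ab by simp
      then show ?thesis
        by (rule piecewise_C1_differentiable_on_cong) (use 2 in \<open>auto simp: joinpaths_def\<close>)
    next
      case 3
      then have "(\<lambda>t. if t \<le> 1/2 then \<phi> (\<gamma> (2*t)) else \<phi> (\<sigma> (2*t-1))) piecewise_C1_differentiable_on {a..b}"
        using first[of "1/2"] second[of "1/2"] eq by (intro piecewise_C1_differentiable_cases) auto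
      then show ?thesis
        by (rule piecewise_C1_differentiable_on_cong) (auto simp: joinpaths_def)
    qed
  qed
  ultimately show ?thesis
    unfolding piecewise_C1_path_def by auto
qed

text \<open>Any two points of a coordinate disc are joined by a segment in the coordinate, so
  reachability from \<open>y\<close> spreads within each disc, and connectedness does the
  rest.\<close>

lemma piecewise_C1_path_exists: "\<exists>\<gamma>. piecewise_C1_path \<A> \<gamma> \<and> \<gamma> 0 = y \<and> \<gamma> 1 = z"
proof -
  define reach where "reach z \<longleftrightarrow> (\<exists>\<gamma>. piecewise_C1_path \<A> \<gamma> \<and> \<gamma> 0 = y \<and> \<gamma> 1 = z)" for z
  have local_path: "\<exists>T. open T \<and> z \<in> T \<and> (\<forall>u\<in>T. \<forall>v\<in>T. \<exists>\<sigma>. piecewise_C1_path \<A> \<sigma> \<and> \<sigma> 0 = u \<and> \<sigma> 1 = v)" for z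
  proof -
    obtain U \<phi> where U: "(U, \<phi>) \<in> \<A>" "z \<in> U" by (rule chart_at)
    obtain r M where M: "ball (\<phi> z) r \<subseteq> \<phi> ` (U \<inter> UNIV)" "open M" "z \<in> M" "M \<subseteq> U \<inter> UNIV" "\<phi> ` M = ball (\<phi> z) r"
      by (rule coordinate_ball[OF U open_UNIV UNIV_I])
    have "\<exists>\<sigma>. piecewise_C1_path \<A> \<sigma> \<and> \<sigma> 0 = u \<and> \<sigma> 1 = v" if uv: "u \<in> M" "v \<in> M" for u v
    proof -
      have "\<phi> u \<in> ball (\<phi> z) r" "\<phi> v \<in> ball (\<phi> z) r" using M(5) uv by blast+
      then have "closed_segment (\<phi> u) (\<phi> v) \<subseteq> ball (\<phi> z) r"
        by (intro closed_segment_subset convex_ball)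
      then have "piecewise_C1_path \<A> (inv_into U \<phi> \<circ> linepath (\<phi> u) (\<phi> v))"
        using M(1) by (intro piecewise_C1_path_line[OF U(1)]) blast
      moreover have "(inv_into U \<phi> \<circ> linepath (\<phi> u) (\<phi> v)) 0 = u" "(inv_into U \<phi> \<circ> linepath (\<phi> u) (\<phi> v)) 1 = v"
        using chart_inv[OF U(1)] uv M(4) by (auto simp: linepath_def)
      ultimately show ?thesis by blast
    qed
    with M(2,3) show ?thesis by blast
  qed
  have "reach z"
  proof (rule connected_induction_simple[of UNIV y z reach])
    show "connected (UNIV :: 'a set)" using riemann_surface by (simp add: riemann_surface_def)
    show "reach y" using local_path[of y] unfolding reach_def by blast
    fix z :: 'a
    obtain T where T: "open T" "z \<in> T" "\<And>u v. u \<in> T \<Longrightarrow> v \<in> T \<Longrightarrow> \<exists>\<sigma>. piecewise_C1_path \<A> \<sigma> \<and> \<sigma> 0 = u \<and> \<sigma> 1 = v"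
      using local_path[of z] by blast
    have "reach v" if uv: "u \<in> T" "v \<in> T" "reach u" for u v
    proof -
      obtain \<gamma> \<sigma> where "piecewise_C1_path \<A> \<gamma>" "\<gamma> 0 = y" "\<gamma> 1 = u" "piecewise_C1_path \<A> \<sigma>" "\<sigma> 0 = u" "\<sigma> 1 = v"
        using T(3)[OF uv(1,2)] uv(3) unfolding reach_def by blast
      then have "piecewise_C1_path \<A> (\<gamma> +++ \<sigma>)" "(\<gamma> +++ \<sigma>) 0 = y" "(\<gamma> +++ \<sigma>) 1 = v"
        by (auto intro: piecewise_C1_path_join) (auto simp: joinpaths_def)
      then show ?thesis unfolding reach_def by blast
    qed
    then have "\<forall>x\<in>T. \<forall>y\<in>T. reach x \<longrightarrow> reach y" by blast
    then show "\<exists>T. openin (top_of_set UNIV) T \<and> z \<in> T \<and> (\<forall>x\<in>T. \<forall>y\<in>T. reach x \<longrightarrow> reach y)"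
      using T(1,2) by (intro exI[of _ T]) simp
  qed auto
  then show ?thesis by (simp add: reach_def)
qed

lemma path_connected_surface: "path_connected (UNIV :: 'a set)"
  unfolding path_connected_def pathstart_def pathfinish_def
proof (intro ballI)
  fix y z
  obtain \<gamma> where "piecewise_C1_path \<A> \<gamma>" "\<gamma> 0 = y" "\<gamma> 1 = z"
    using piecewise_C1_path_exists by blast
  then show "\<exists>g. path g \<and> path_image g \<subseteq> UNIV \<and> g 0 = y \<and> g 1 = z"
    by (auto simp: piecewise_C1_path_def)
qed

section \<open>Global primitives and the fundamental theorem of calculus\<close>

lemma primitive_exists:
  assumes sc: "simply_connected (UNIV :: 'a set)" and \<omega>: "\<omega> \<in> holo_forms \<A>"
  obtains G where "G \<in> holo_functions \<A>" "ext_deriv \<A> G = \<omega>"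
proof -
  obtain F W where FW: "\<And>x. x \<in> W x" "\<And>x. local_primitive \<omega> (F x) (W x)"
    using local_primitive_exists[OF \<omega>] by metis
  have W: "\<forall>\<^sub>F y in nhds x. y \<in> W x" for x
    using FW by (intro eventually_nhds_in_open) (auto simp: local_primitive_def)
  \<comment> \<open>For \<open>y\<close> in \<open>W x\<close> both \<open>F x\<close> and
    \<open>F y\<close> are primitives near \<open>y\<close>, so their increments from
    \<open>y\<close> agree; this is the cocycle law.\<close>
  interpret local_cocycle "\<lambda>x y. F x y - F x x"
  proof
    fix x
    show "\<forall>\<^sub>F y in nhds x. \<forall>\<^sub>F z in nhds y. F x z - F x x = F x y - F x x + (F y z - F y y)"
      using W[of x]
    proof eventually_elim
      case (elim y)
      from local_primitive_unique[OF FW(2) FW(2) elim FW(1)] show ?case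
        by eventually_elim (simp add: algebra_simps)
    qed
  qed
  obtain G where G: "\<And>x. \<forall>\<^sub>F y in nhds x. G y = G x + (F x y - F x x)"
    using simply_connected_coboundary[OF sc path_connected_surface locally_path_connected_surface] by blast
  have der: "((G \<circ> inv_into U \<phi>) has_field_derivative \<omega> (U, \<phi>) z) (at (\<phi> z))"
    if U: "(U, \<phi>) \<in> \<A>" "z \<in> U" for U \<phi> z
  proof -
    \<comment> \<open>Near \<open>z\<close> the function \<open>G\<close> differs from
      \<open>F z\<close> by a constant, so it inherits the derivative.\<close>
    have "((F z \<circ> inv_into U \<phi>) has_field_derivative \<omega> (U, \<phi>) z) (at (\<phi> z))"
      using FW U unfolding local_primitive_def by fast
    from DERIV_add[OF DERIV_const this]
    have "((\<lambda>w. (G z - F z z) + (F z \<circ> inv_into U \<phi>) w) has_field_derivative \<omega> (U, \<phi>) z) (at (\<phi> z))"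
      by simp
    moreover have "\<forall>\<^sub>F w in nhds (\<phi> z). (G z - F z z) + (F z \<circ> inv_into U \<phi>) w = (G \<circ> inv_into U \<phi>) w"
      using eventually_coord[OF U G[of z]] by eventually_elim simp
    ultimately show ?thesis
      by (rule has_field_derivative_eventually_cong)
  qed
  \<comment> \<open>Equality of forms is also required where the coefficient has no meaning; both
    sides are 0 there.\<close>
  have "ext_deriv \<A> G c z = \<omega> c z" for c z
  proof (cases "c \<in> \<A> \<and> z \<in> fst c")
    case True
    then obtain U \<phi> where U: "c = (U, \<phi>)" "(U, \<phi>) \<in> \<A>" "z \<in> U" by (cases c) auto
    show ?thesis unfolding U(1) by (rule ext_deriv_eqI[OF U(2,3) der[OF U(2,3)]])
  next
    case False
    then have "\<omega> c z = 0" by (intro holo_forms_outside[OF \<omega>]) blast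
    moreover have "ext_deriv \<A> G c z = 0" using False by (intro ext_deriv_outside) blast
    ultimately show ?thesis by simp
  qed
  then have "ext_deriv \<A> G = \<omega>" by (intro ext)
  moreover have "G \<in> holo_functions \<A>"
    by (rule holo_functionsI[where D = "\<lambda>U \<phi>. \<omega> (U, \<phi>)"]) (rule der)
  ultimately show ?thesis using that by blast
qed

text \<open>The integrand changes charts arbitrarily with the parameter, so no continuity of it can
  be used. On short intervals it is nevertheless the derivative of \<open>f \<circ> \<gamma>\<close>
  off a finite set, and with a continuous primitive this is enough for the gauge integral.\<close>

lemma path_integral_ext_deriv:
  assumes f: "f \<in> holo_functions \<A>" and \<gamma>: "piecewise_C1_path \<A> \<gamma>"
  shows "path_integral \<A> \<gamma> (ext_deriv \<A> f) = f (\<gamma> 1) - f (\<gamma> 0)"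
proof -
  define c where "c t = (SOME c. c \<in> \<A> \<and> \<gamma> t \<in> fst c)" for t
  define g where "g t = ext_deriv \<A> f (c t) (\<gamma> t) * vector_derivative (snd (c t) \<circ> \<gamma>) (at t within {0..1})" for t
  have cont: "continuous_on {0..1} \<gamma>" using \<gamma> by (simp add: piecewise_C1_path_def path_def)
  have c: "c t \<in> \<A>" "\<gamma> t \<in> fst (c t)" for t
  proof -
    have "\<exists>c. c \<in> \<A> \<and> \<gamma> t \<in> fst c" using chart_at[of "\<gamma> t"] by (metis fst_conv)
    then have "c t \<in> \<A> \<and> \<gamma> t \<in> fst (c t)" unfolding c_def by (rule someI_ex)
    then show "c t \<in> \<A>" "\<gamma> t \<in> fst (c t)" by auto
  qed
  have lim: "filterlim \<gamma> (nhds (\<gamma> t)) (nhds t)" if "0 < t" "t < 1" for t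
  proof -
    have "isCont \<gamma> t" by (rule continuous_on_interior[OF cont]) (use that in auto)
    then show ?thesis by (simp add: isCont_def tendsto_at_iff_tendsto_nhds)
  qed
  have deriv: "((f \<circ> \<gamma>) has_vector_derivative g t) (at t)"
    if U: "(U, \<phi>) \<in> \<A>" "\<gamma> t \<in> U" and d: "((\<phi> \<circ> \<gamma>) has_vector_derivative d) (at t)" and t: "0 < t" "t < 1" for U \<phi> t d
  proof -
    obtain V \<psi> where ct: "c t = (V, \<psi>)" by fastforce
    have V: "(V, \<psi>) \<in> \<A>" "\<gamma> t \<in> V" using c[of t] ct by auto
    have *: "\<forall>\<^sub>F s in nhds t. \<gamma> s \<in> U" "\<forall>\<^sub>F s in nhds t. \<gamma> s \<in> V"
      using eventually_compose_filterlim[OF eventually_in_chart lim[OF t]] U V by auto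
    have cong: "(h has_vector_derivative e) (at t)"
      if "(k has_vector_derivative e) (at t)" "\<forall>\<^sub>F s in nhds t. h s = k s" for h k :: "real \<Rightarrow> complex" and e
      using that(1) has_vector_derivative_cong_ev[of UNIV h k t e] eventually_nhds_x_imp_x[OF that(2)] that(2)
      by simp
    \<comment> \<open>Differentiability is given in the chart \<open>U\<close>; the transition map
      carries it to the chart chosen by the integrand.\<close>
    have "((\<psi> \<circ> inv_into U \<phi> \<circ> (\<phi> \<circ> \<gamma>)) has_vector_derivative d * deriv (\<psi> \<circ> inv_into U \<phi>) (\<phi> (\<gamma> t))) (at t)"
      using U V by (intro field_vector_diff_chain_at[OF d]) (auto intro: transition_deriv)
    moreover have "\<forall>\<^sub>F s in nhds t. (\<psi> \<circ> \<gamma>) s = (\<psi> \<circ> inv_into U \<phi> \<circ> (\<phi> \<circ> \<gamma>)) s"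
      using *(1) by eventually_elim (simp add: chart_inv[OF U(1)])
    ultimately have e: "((\<psi> \<circ> \<gamma>) has_vector_derivative d * deriv (\<psi> \<circ> inv_into U \<phi>) (\<phi> (\<gamma> t))) (at t)"
      by (rule cong)
    \<comment> \<open>At an interior parameter the derivative relative to \<open>{0..1}\<close> is
      the two-sided one.\<close>
    from has_vector_derivative_at_within[OF this]
    have "vector_derivative (\<psi> \<circ> \<gamma>) (at t within {0..1}) = d * deriv (\<psi> \<circ> inv_into U \<phi>) (\<phi> (\<gamma> t))"
      using t by (rule_tac vector_derivative_within_cbox[of 0 1, unfolded box_real]) auto
    with e have e': "((\<psi> \<circ> \<gamma>) has_vector_derivative vector_derivative (\<psi> \<circ> \<gamma>) (at t within {0..1})) (at t)"
      by simp
    have "((f \<circ> inv_into V \<psi> \<circ> (\<psi> \<circ> \<gamma>)) has_vector_derivative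
        vector_derivative (\<psi> \<circ> \<gamma>) (at t within {0..1}) * ext_deriv \<A> f (V, \<psi>) (\<gamma> t)) (at t)"
      using holo_has_field_derivative[OF f V] by (intro field_vector_diff_chain_at[OF e']) simp
    moreover have "\<forall>\<^sub>F s in nhds t. (f \<circ> \<gamma>) s = (f \<circ> inv_into V \<psi> \<circ> (\<psi> \<circ> \<gamma>)) s"
      using *(2) by eventually_elim (simp add: chart_inv[OF V(1)])
    ultimately show ?thesis
      unfolding g_def ct snd_conv mult.commute[of "ext_deriv _ _ _ _"] by (rule cong)
  qed
  have fcont: "continuous_on {0..1} (f \<circ> \<gamma>)"
    using cont holo_continuous[OF f] by (intro continuous_on_compose) (auto intro: continuous_on_subset)
  define P where "P a b \<longleftrightarrow> (0 \<le> a \<longrightarrow> a \<le> b \<longrightarrow> b \<le> 1 \<longrightarrow> (g has_integral f (\<gamma> b) - f (\<gamma> a)) {a..b})" for a b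
  have "P 0 1"
  proof (rule Bolzano)
    show "(0::real) \<le> 1" by simp
  next
    fix u v w assume *: "P u v" "P v w" "u \<le> v" "v \<le> w"
    show "P u w"
      unfolding P_def
    proof (intro impI)
      assume "0 \<le> u" "u \<le> w" "w \<le> 1"
      with * have "(g has_integral f (\<gamma> v) - f (\<gamma> u)) {u..v}" "(g has_integral f (\<gamma> w) - f (\<gamma> v)) {v..w}"
        by (auto simp: P_def)
      from has_integral_combine[OF *(3,4) this]
      show "(g has_integral f (\<gamma> w) - f (\<gamma> u)) {u..w}" by simp
    qed
  next
    fix t :: real assume t: "0 \<le> t" "t \<le> 1"
    obtain U \<phi> where U: "(U, \<phi>) \<in> \<A>" "\<gamma> t \<in> U" by (rule chart_at)
    have "filterlim \<gamma> (nhds (\<gamma> t)) (at t within {0..1})"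
      using cont t by (auto simp: continuous_on_def)
    then have "\<forall>\<^sub>F s in at t within {0..1}. \<gamma> s \<in> U"
      using topological_tendstoD chart_open[OF U(1)] U(2) by blast
    then obtain r where r: "r > 0" "\<And>s. s \<in> {0..1} \<Longrightarrow> s \<noteq> t \<Longrightarrow> dist s t < r \<Longrightarrow> \<gamma> s \<in> U"
      unfolding eventually_at by blast
    have "(g has_integral f (\<gamma> b) - f (\<gamma> a)) {a..b}"
      if ab: "a \<le> t" "t \<le> b" "b - a < r" "0 \<le> a" "b \<le> 1" for a b
    proof -
      have sub: "\<gamma> s \<in> U" if "s \<in> {a..b}" for s
        using r(2)[of s] U(2) ab that by (cases "s = t") (auto simp: dist_real_def)
      then have "\<gamma> ` {a..b} \<subseteq> U" by blast
      with \<gamma> U(1) have "(\<phi> \<circ> \<gamma>) piecewise_C1_differentiable_on {a..b}"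
        using ab by (intro piecewise_C1_path_chart) auto
      then obtain S D where S: "finite S" "\<And>s. s \<in> {a..b} - S \<Longrightarrow> ((\<phi> \<circ> \<gamma>) has_vector_derivative D s) (at s)"
        unfolding piecewise_C1_differentiable_on_def C1_differentiable_on_def by blast
      have "(g has_integral (f \<circ> \<gamma>) b - (f \<circ> \<gamma>) a) {a..b}"
      proof (rule fundamental_theorem_of_calculus_interior_strong[OF S(1)])
        show "a \<le> b" using ab by simp
        show "continuous_on {a..b} (f \<circ> \<gamma>)" using fcont by (rule continuous_on_subset) (use ab in auto)
        show "((f \<circ> \<gamma>) has_vector_derivative g s) (at s)" if "s \<in> {a<..<b} - S" for s
          using that ab by (intro deriv[OF U(1) sub S(2)]) auto
      qed
      then show ?thesis by simp
    qed
    then show "\<exists>d>0. \<forall>a b. a \<le> t \<and> t \<le> b \<and> b - a < d \<longrightarrow> P a b"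
      unfolding P_def using r(1) by blast
  qed
  then have "(g has_integral f (\<gamma> 1) - f (\<gamma> 0)) {0..1}" by (simp add: P_def)
  then show ?thesis
    unfolding path_integral_def Let_def g_def c_def by (rule integral_unique)
qed

text \<open>All paths give the same value and at least one path exists, so the definite description
  denotes it.\<close>

lemma integral_from_to_ext_deriv:
  assumes "f \<in> holo_functions \<A>"
  shows "integral_from_to \<A> (ext_deriv \<A> f) y z = f z - f y"
  unfolding integral_from_to_def pathstart_def pathfinish_def
proof (rule the_equality)
  obtain \<gamma> where "piecewise_C1_path \<A> \<gamma>" "\<gamma> 0 = y" "\<gamma> 1 = z"
    using piecewise_C1_path_exists by blast
  with path_integral_ext_deriv[OF assms]
  show "\<exists>\<gamma>. piecewise_C1_path \<A> \<gamma> \<and> \<gamma> 0 = y \<and> \<gamma> 1 = z \<and> path_integral \<A> \<gamma> (ext_deriv \<A> f) = f z - f y"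
    by blast
qed (use path_integral_ext_deriv[OF assms] in auto)

end

section \<open>Iterated integrals\<close>

lemma unital_subalgebra_const:
  assumes "unital_subalgebra A"
  shows "(\<lambda>_. a) \<in> A"
proof -
  have "\<forall>a. \<forall>f \<in> A. (\<lambda>z. a * f z) \<in> A" "(\<lambda>z. 1) \<in> A"
    using assms by (simp_all add: unital_subalgebra_def)
  from bspec[OF spec[OF this(1), of a] this(2)] show ?thesis by simp
qed

lemma unital_subalgebra_add: "unital_subalgebra A \<Longrightarrow> f \<in> A \<Longrightarrow> g \<in> A \<Longrightarrow> (\<lambda>z. f z + g z) \<in> A"
  by (simp add: unital_subalgebra_def)

section \<open>Chain rule for polynomials along holomorphic curves\<close>

text \<open>The map \<open>L\<close> is chosen before the curve and depends only on the point
  \<open>x\<close>. It can thus be computed on one curve and applied to all others.\<close>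

lemma polynomial_functions_differential_ex:
  assumes "f \<in> polynomial_functions"
  shows "\<exists>L. \<forall>(q :: complex \<Rightarrow> complex ^ 'n) w v. q w = x \<longrightarrow>
    (\<forall>i. ((\<lambda>t. q t $ i) has_field_derivative v $ i) (at w)) \<longrightarrow>
    ((\<lambda>t. f (q t)) has_field_derivative L v) (at w)"
  using assms
proof induction
  case (const c)
  show ?case by (rule exI[of _ "\<lambda>_. 0"]) auto
next
  case (coord i)
  show ?case by (intro exI[of _ "\<lambda>v. v $ i"] allI impI) blast
next
  case (add f g)
  then obtain L M where
    L: "\<And>q w v. q w = x \<Longrightarrow> (\<forall>i. ((\<lambda>t. q t $ i) has_field_derivative v $ i) (at w)) \<Longrightarrow> ((\<lambda>t. f (q t)) has_field_derivative L v) (at w)" and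
    M: "\<And>q w v. q w = x \<Longrightarrow> (\<forall>i. ((\<lambda>t. q t $ i) has_field_derivative v $ i) (at w)) \<Longrightarrow> ((\<lambda>t. g (q t)) has_field_derivative M v) (at w)"
    by metis
  show ?case
    by (rule exI[of _ "\<lambda>v. L v + M v"], intro allI impI, rule DERIV_add, erule L, assumption, erule M)
next
  case (mult f g)
  then obtain L M where
    L: "\<And>q w v. q w = x \<Longrightarrow> (\<forall>i. ((\<lambda>t. q t $ i) has_field_derivative v $ i) (at w)) \<Longrightarrow> ((\<lambda>t. f (q t)) has_field_derivative L v) (at w)" and
    M: "\<And>q w v. q w = x \<Longrightarrow> (\<forall>i. ((\<lambda>t. q t $ i) has_field_derivative v $ i) (at w)) \<Longrightarrow> ((\<lambda>t. g (q t)) has_field_derivative M v) (at w)"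
    by metis
  show ?case
  proof (rule exI[of _ "\<lambda>v. L v * g x + M v * f x"], intro allI impI)
    fix q :: "complex \<Rightarrow> complex ^ 'n" and w v
    assume q: "q w = x" "\<forall>i. ((\<lambda>t. q t $ i) has_field_derivative v $ i) (at w)"
    from DERIV_mult[OF L[OF q] M[OF q]] q(1)
    show "((\<lambda>t. f (q t) * g (q t)) has_field_derivative L v * g x + M v * f x) (at w)" by simp
  qed
qed

lemma polynomial_functions_chain:
  fixes q :: "complex \<Rightarrow> complex ^ 'n"
  assumes f: "f \<in> polynomial_functions"
    and q: "\<And>i. ((\<lambda>t. q t $ i) has_field_derivative v $ i) (at w)"
  shows "((\<lambda>t. f (q t)) has_field_derivative differential_at f (q w) v) (at w)"
proof -
  obtain L where L: "\<And>(r :: complex \<Rightarrow> complex ^ 'n) u v. r u = q w \<Longrightarrow>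
      (\<forall>i. ((\<lambda>t. r t $ i) has_field_derivative v $ i) (at u)) \<Longrightarrow>
      ((\<lambda>t. f (r t)) has_field_derivative L v) (at u)"
    using polynomial_functions_differential_ex[OF f, of "q w"] by blast
  \<comment> \<open>The straight line in direction \<open>v\<close> is the test curve that defines
    \<open>differential_at\<close>, which identifies \<open>L v\<close>.\<close>
  have "((\<lambda>t. f (q w + t *s v)) has_field_derivative L v) (at 0)"
    by (rule L) (auto intro!: derivative_eq_intros)
  then have "differential_at f (q w) v = L v"
    unfolding differential_at_def by (rule DERIV_imp_deriv)
  then show ?thesis using L[of q w v] q by simp
qed

context surface
begin

section \<open>Calculus of holomorphic functions and forms\<close>

lemma holo_add: "f \<in> holo_functions \<A> \<Longrightarrow> g \<in> holo_functions \<A> \<Longrightarrow> (\<lambda>z. f z + g z) \<in> holo_functions \<A>"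
  and ext_deriv_add: "f \<in> holo_functions \<A> \<Longrightarrow> g \<in> holo_functions \<A> \<Longrightarrow>
    ext_deriv \<A> (\<lambda>z. f z + g z) = (\<lambda>c z. ext_deriv \<A> f c z + ext_deriv \<A> g c z)"
proof -
  assume fg: "f \<in> holo_functions \<A>" "g \<in> holo_functions \<A>"
  have *: "(((\<lambda>z. f z + g z) \<circ> inv_into U \<phi>) has_field_derivative
      ext_deriv \<A> f (U, \<phi>) z + ext_deriv \<A> g (U, \<phi>) z) (at (\<phi> z))" if U: "(U, \<phi>) \<in> \<A>" "z \<in> U" for U \<phi> z
    using DERIV_add[OF fg[THEN holo_has_field_derivative[OF _ U]]] by (simp add: o_def)
  then show "(\<lambda>z. f z + g z) \<in> holo_functions \<A>"
    by (rule holo_functionsI)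
  show "ext_deriv \<A> (\<lambda>z. f z + g z) = (\<lambda>c z. ext_deriv \<A> f c z + ext_deriv \<A> g c z)"
  proof (intro ext)
    fix c z
    show "ext_deriv \<A> (\<lambda>z. f z + g z) c z = ext_deriv \<A> f c z + ext_deriv \<A> g c z"
    proof (cases "c \<in> \<A> \<and> z \<in> fst c")
      case True
      then obtain U \<phi> where U: "c = (U, \<phi>)" "(U, \<phi>) \<in> \<A>" "z \<in> U" by (cases c) auto
      show ?thesis unfolding U(1) by (rule ext_deriv_eqI[OF U(2,3) *[OF U(2,3)]])
    next
      case False
      then show ?thesis by (simp add: ext_deriv_outside)
    qed
  qed
qed

lemma holo_mult: "f \<in> holo_functions \<A> \<Longrightarrow> g \<in> holo_functions \<A> \<Longrightarrow> (\<lambda>z. f z * g z) \<in> holo_functions \<A>"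
  and ext_deriv_mult: "f \<in> holo_functions \<A> \<Longrightarrow> g \<in> holo_functions \<A> \<Longrightarrow>
    ext_deriv \<A> (\<lambda>z. f z * g z) = (\<lambda>c z. g z * ext_deriv \<A> f c z + f z * ext_deriv \<A> g c z)"
proof -
  assume fg: "f \<in> holo_functions \<A>" "g \<in> holo_functions \<A>"
  have *: "(((\<lambda>z. f z * g z) \<circ> inv_into U \<phi>) has_field_derivative
      g z * ext_deriv \<A> f (U, \<phi>) z + f z * ext_deriv \<A> g (U, \<phi>) z) (at (\<phi> z))" if U: "(U, \<phi>) \<in> \<A>" "z \<in> U" for U \<phi> z
    using DERIV_mult[OF fg[THEN holo_has_field_derivative[OF _ U]]]
    by (simp add: o_def chart_inv[OF U] mult.commute)
  then show "(\<lambda>z. f z * g z) \<in> holo_functions \<A>"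
    by (rule holo_functionsI)
  show "ext_deriv \<A> (\<lambda>z. f z * g z) = (\<lambda>c z. g z * ext_deriv \<A> f c z + f z * ext_deriv \<A> g c z)"
  proof (intro ext)
    fix c z
    show "ext_deriv \<A> (\<lambda>z. f z * g z) c z = g z * ext_deriv \<A> f c z + f z * ext_deriv \<A> g c z"
    proof (cases "c \<in> \<A> \<and> z \<in> fst c")
      case True
      then obtain U \<phi> where U: "c = (U, \<phi>)" "(U, \<phi>) \<in> \<A>" "z \<in> U" by (cases c) auto
      show ?thesis unfolding U(1) by (rule ext_deriv_eqI[OF U(2,3) *[OF U(2,3)]])
    next
      case False
      then show ?thesis by (simp add: ext_deriv_outside)
    qed
  qed
qed

lemma ext_deriv_const: "ext_deriv \<A> (\<lambda>_. a) = (\<lambda>c z. 0)"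
  by (simp add: ext_deriv_def fun_eq_iff o_def)

text \<open>The increments of \<open>F\<close> and \<open>G\<close> from \<open>y\<close> to
  \<open>z\<close> are the integral of one and the same form.\<close>

lemma ext_deriv_eq_imp:
  assumes "F \<in> holo_functions \<A>" "G \<in> holo_functions \<A>" "ext_deriv \<A> F = ext_deriv \<A> G"
  shows "F z = G z + (F y - G y)"
  using integral_from_to_ext_deriv[OF assms(1), of y z] integral_from_to_ext_deriv[OF assms(2), of y z]
  by (simp add: assms(3) algebra_simps)

lemma holo_forms_zero: "(\<lambda>c z. 0) \<in> holo_forms \<A>"
  using ext_deriv_holo_forms[OF holo_const[of 0]] by (simp add: ext_deriv_const)

lemma holo_forms_add:
  assumes "\<omega> \<in> holo_forms \<A>" "\<eta> \<in> holo_forms \<A>"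
  shows "(\<lambda>c z. \<omega> c z + \<eta> c z) \<in> holo_forms \<A>"
proof (rule holo_formsI)
  fix U \<phi> assume U: "(U, \<phi>) \<in> \<A>"
  have "(\<omega> (U, \<phi>) \<circ> inv_into U \<phi>) holomorphic_on \<phi> ` U" "(\<eta> (U, \<phi>) \<circ> inv_into U \<phi>) holomorphic_on \<phi> ` U"
    using assms[THEN holo_forms_holomorphic] U by blast+
  then have "(\<lambda>w. (\<omega> (U, \<phi>) \<circ> inv_into U \<phi>) w + (\<eta> (U, \<phi>) \<circ> inv_into U \<phi>) w) holomorphic_on \<phi> ` U"
    by (rule holomorphic_on_add)
  then show "((\<lambda>z. \<omega> (U, \<phi>) z + \<eta> (U, \<phi>) z) \<circ> inv_into U \<phi>) holomorphic_on \<phi> ` U"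
    by (simp add: o_def)
next
  fix U \<phi> V \<psi> z assume "(U, \<phi>) \<in> \<A>" "(V, \<psi>) \<in> \<A>" "z \<in> U" "z \<in> V"
  then have "\<omega> (U, \<phi>) z = \<omega> (V, \<psi>) z * deriv (\<psi> \<circ> inv_into U \<phi>) (\<phi> z)"
    "\<eta> (U, \<phi>) z = \<eta> (V, \<psi>) z * deriv (\<psi> \<circ> inv_into U \<phi>) (\<phi> z)"
    using assms[THEN holo_forms_transition] by blast+
  then show "\<omega> (U, \<phi>) z + \<eta> (U, \<phi>) z = (\<omega> (V, \<psi>) z + \<eta> (V, \<psi>) z) * deriv (\<psi> \<circ> inv_into U \<phi>) (\<phi> z)"
    by (simp add: algebra_simps)
next
  fix c z assume "c \<notin> \<A> \<or> z \<notin> fst c"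
  then show "\<omega> c z + \<eta> c z = 0"
    using assms[THEN holo_forms_outside] by simp
qed

lemma holo_forms_sum:
  fixes m :: nat
  assumes "\<And>i. i < m \<Longrightarrow> \<omega> i \<in> holo_forms \<A>"
  shows "(\<lambda>c z. \<Sum>i<m. \<omega> i c z) \<in> holo_forms \<A>"
  using assms
proof (induction m)
  case 0
  show ?case by (simp add: holo_forms_zero)
next
  case (Suc m)
  then have "(\<lambda>c z. \<Sum>i<m. \<omega> i c z) \<in> holo_forms \<A>" "\<omega> m \<in> holo_forms \<A>" by simp_all
  from holo_forms_add[OF this] show ?case by simp
qed

lemma holo_forms_fun_times:
  assumes f: "f \<in> holo_functions \<A>" and \<omega>: "\<omega> \<in> holo_forms \<A>"
  shows "fun_times_form f \<omega> \<in> holo_forms \<A>"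
  unfolding fun_times_form_def
proof (rule holo_formsI)
  fix U \<phi> assume U: "(U, \<phi>) \<in> \<A>"
  have "(f \<circ> inv_into U \<phi>) holomorphic_on \<phi> ` U"
    using holo_functions_chart[OF f U] .
  moreover have "(\<omega> (U, \<phi>) \<circ> inv_into U \<phi>) holomorphic_on \<phi> ` U"
    using holo_forms_holomorphic[OF \<omega> U] .
  ultimately have "(\<lambda>w. (f \<circ> inv_into U \<phi>) w * (\<omega> (U, \<phi>) \<circ> inv_into U \<phi>) w) holomorphic_on \<phi> ` U"
    by (rule holomorphic_on_mult)
  then show "((\<lambda>z. f z * \<omega> (U, \<phi>) z) \<circ> inv_into U \<phi>) holomorphic_on \<phi> ` U"
    by (simp add: o_def)
next
  fix U \<phi> V \<psi> z assume "(U, \<phi>) \<in> \<A>" "(V, \<psi>) \<in> \<A>" "z \<in> U" "z \<in> V"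
  then have "\<omega> (U, \<phi>) z = \<omega> (V, \<psi>) z * deriv (\<psi> \<circ> inv_into U \<phi>) (\<phi> z)"
    by (rule holo_forms_transition[OF \<omega>])
  then show "f z * \<omega> (U, \<phi>) z = f z * \<omega> (V, \<psi>) z * deriv (\<psi> \<circ> inv_into U \<phi>) (\<phi> z)"
    by simp
next
  fix c z assume "c \<notin> \<A> \<or> z \<notin> fst c"
  then show "f z * \<omega> c z = 0"
    using holo_forms_outside[OF \<omega>] by simp
qed

end

section \<open>Pullback from the curve to its cover\<close>

locale affine_cover =
  fixes \<A> :: "'a::t2_space chart set"
    and p :: "'a \<Rightarrow> complex ^ 'n"
    and C :: "(complex ^ 'n) set"
  assumes universal_cover: "universal_cover \<A> p C"
begin

sublocale surface \<A>
  using universal_cover unfolding universal_cover_def by unfold_locales simp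

lemma total_simply_connected: "simply_connected (UNIV :: 'a set)"
  using universal_cover by (simp add: universal_cover_def)

lemma cover_in_curve: "p z \<in> C"
  using universal_cover covering_space_imp_surjective unfolding universal_cover_def by blast

text \<open>The image of the coordinate vector of the chart under the differential of
  \<open>p\<close>; this is the vector to which \<open>pullback_form\<close> applies a
  differential.\<close>

definition velocity :: "'a set \<Rightarrow> ('a \<Rightarrow> complex) \<Rightarrow> 'a \<Rightarrow> complex ^ 'n" where
  "velocity U \<phi> z = (\<chi> i. deriv (\<lambda>t. p (inv_into U \<phi> t) $ i) (\<phi> z))"

lemma
  assumes f: "f \<in> polynomial_functions"
  shows polynomial_pullback_holo: "(\<lambda>z. f (p z)) \<in> holo_functions \<A>"
    and ext_deriv_polynomial_pullback: "(U, \<phi>) \<in> \<A> \<Longrightarrow> z \<in> U \<Longrightarrow> ext_deriv \<A> (\<lambda>z. f (p z)) (U, \<phi>) z =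
      differential_at f (p z) (velocity U \<phi> z)"
proof -
  have *: "(((\<lambda>z. f (p z)) \<circ> inv_into U \<phi>) has_field_derivative
      differential_at f (p z) (velocity U \<phi> z)) (at (\<phi> z))"
    if U: "(U, \<phi>) \<in> \<A>" "z \<in> U" for U \<phi> z
  proof -
    have "((\<lambda>t. p (inv_into U \<phi> t) $ i) has_field_derivative
        velocity U \<phi> z $ i) (at (\<phi> z))" for i
    proof -
      have "(\<lambda>z. p z $ i) \<in> holo_functions \<A>"
        using universal_cover by (simp add: universal_cover_def)
      from holo_has_field_derivative[OF this U] show ?thesis
        using U by (simp add: o_def ext_deriv_def velocity_def)
    qed
    from polynomial_functions_chain[OF f this] show ?thesis
      by (simp add: o_def chart_inv[OF U])
  qed
  then show "(\<lambda>z. f (p z)) \<in> holo_functions \<A>"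
    by (rule holo_functionsI)
  show "ext_deriv \<A> (\<lambda>z. f (p z)) (U, \<phi>) z =
      differential_at f (p z) (velocity U \<phi> z)"
    if U: "(U, \<phi>) \<in> \<A>" "z \<in> U"
    by (rule ext_deriv_eqI[OF U *[OF U]])
qed

text \<open>A polynomial vanishing on \<open>C\<close> pulls back to the zero function, whose
  differential is 0.\<close>

lemma velocity_tangent:
  assumes "(U, \<phi>) \<in> \<A>" "z \<in> U"
  shows "velocity U \<phi> z \<in> tangent_space C (p z)"
  unfolding tangent_space_def
proof (intro CollectI ballI)
  fix f assume f: "f \<in> vanishing_ideal C"
  then have "(\<lambda>z. f (p z)) = (\<lambda>_. 0)"
    using cover_in_curve by (auto simp: vanishing_ideal_def)
  then show "differential_at f (p z) (velocity U \<phi> z) = 0"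
    using ext_deriv_polynomial_pullback[OF _ assms, of f] f ext_deriv_const[of 0]
    by (simp add: vanishing_ideal_def)
qed

text \<open>The cover maps into \<open>C\<close> with tangent velocities, so the guard in a regular
  differential is always met, and \<open>differential_at\<close> becomes \<open>ext_deriv\<close> by
  the chain rule.\<close>

lemma pullback_form_eq:
  fixes m :: nat
  assumes "\<And>i. i < m \<Longrightarrow> g i \<in> polynomial_functions"
  shows "pullback_form \<A> p (\<lambda>x v. if x \<in> C \<and> v \<in> tangent_space C x
      then \<Sum>i<m. f i x * differential_at (g i) x v else 0) =
    (\<lambda>c z. \<Sum>i<m. f i (p z) * ext_deriv \<A> (\<lambda>z. g i (p z)) c z)"
proof (intro ext)
  fix c z
  show "pullback_form \<A> p (\<lambda>x v. if x \<in> C \<and> v \<in> tangent_space C x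
      then \<Sum>i<m. f i x * differential_at (g i) x v else 0) c z =
    (\<Sum>i<m. f i (p z) * ext_deriv \<A> (\<lambda>z. g i (p z)) c z)"
  proof (cases "c \<in> \<A> \<and> z \<in> fst c")
    case True
    then obtain U \<phi> where U: "c = (U, \<phi>)" "(U, \<phi>) \<in> \<A>" "z \<in> U" by (cases c) auto
    then show ?thesis
      by (simp add: pullback_form_def velocity_def[symmetric] cover_in_curve velocity_tangent ext_deriv_polynomial_pullback[OF assms])
  next
    case False
    then show ?thesis
      by (cases c) (auto simp: pullback_form_def ext_deriv_def)
  qed
qed

lemma pullback_form_holo:
  assumes "\<omega> \<in> regular_differentials C"
  shows "pullback_form \<A> p \<omega> \<in> holo_forms \<A>"
proof -
  obtain m :: nat and f g where fg: "\<And>i. i < m \<Longrightarrow> f i \<in> polynomial_functions" "\<And>i. i < m \<Longrightarrow> g i \<in> polynomial_functions"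
    and \<omega>: "\<omega> = (\<lambda>x v. if x \<in> C \<and> v \<in> tangent_space C x
       then \<Sum>i<m. f i x * differential_at (g i) x v else 0)"
    using assms unfolding regular_differentials_def by blast
  have "(\<lambda>c z. \<Sum>i<m. fun_times_form (\<lambda>z. f i (p z)) (ext_deriv \<A> (\<lambda>z. g i (p z))) c z) \<in> holo_forms \<A>"
    by (intro holo_forms_sum holo_forms_fun_times ext_deriv_holo_forms polynomial_pullback_holo fg)
  moreover have "pullback_form \<A> p \<omega> = (\<lambda>c z. \<Sum>i<m. f i (p z) * ext_deriv \<A> (\<lambda>z. g i (p z)) c z)"
    unfolding \<omega> by (rule pullback_form_eq[OF fg(2)])
  ultimately show ?thesis
    by (simp add: fun_times_form_def)
qed

section \<open>The algebra of iterated integrals\<close>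

text \<open>The rule \<open>integral\<close> admits every holomorphic primitive, so neither a base
  point nor a path integral enters. Closure under scalars is left to be derived, which keeps the
  later inductions to three cases.\<close>

inductive_set iterated_integrals :: "('a \<Rightarrow> complex) set" where
  const: "(\<lambda>_. a) \<in> iterated_integrals"
| add: "f \<in> iterated_integrals \<Longrightarrow> g \<in> iterated_integrals \<Longrightarrow> (\<lambda>z. f z + g z) \<in> iterated_integrals"
| integral: "f \<in> iterated_integrals \<Longrightarrow> \<omega> \<in> regular_differentials C \<Longrightarrow> G \<in> holo_functions \<A> \<Longrightarrow>
    ext_deriv \<A> G = fun_times_form f (pullback_form \<A> p \<omega>) \<Longrightarrow> G \<in> iterated_integrals"

lemma iterated_integrals_holo: "f \<in> iterated_integrals \<Longrightarrow> f \<in> holo_functions \<A>"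
  by (induction rule: iterated_integrals.induct) (auto intro: holo_const holo_add)

lemma iterated_integrals_primitive:
  assumes "f \<in> iterated_integrals" "\<omega> \<in> regular_differentials C"
  obtains G where "G \<in> iterated_integrals" "ext_deriv \<A> G = fun_times_form f (pullback_form \<A> p \<omega>)"
proof -
  have "fun_times_form f (pullback_form \<A> p \<omega>) \<in> holo_forms \<A>"
    by (intro holo_forms_fun_times pullback_form_holo iterated_integrals_holo assms)
  from primitive_exists[OF total_simply_connected this] show ?thesis
    using iterated_integrals.integral[OF assms] that by metis
qed

lemma iterated_integrals_scale:
  assumes "f \<in> iterated_integrals"
  shows "(\<lambda>z. a * f z) \<in> iterated_integrals"
  using assms
proof induction
  case (add f g)
  then show ?case using iterated_integrals.add[OF add.IH] by (simp add: distrib_left)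
next
  case (integral f \<omega> G)
  have "ext_deriv \<A> (\<lambda>z. a * G z) = fun_times_form (\<lambda>z. a * f z) (pullback_form \<A> p \<omega>)"
    using ext_deriv_mult[OF holo_const[of a] integral.hyps(3)] integral.hyps(4)
    by (simp add: ext_deriv_const fun_times_form_def mult.assoc)
  then show ?case
    by (rule iterated_integrals.integral[OF integral.IH integral.hyps(2) holo_mult[OF holo_const integral.hyps(3)]])
qed (rule iterated_integrals.const)

text \<open>Shuffle relation: \<open>F G\<close> is a primitive of \<open>G dF + F dG\<close>, and both summands lead back to
  products with a shorter factor.\<close>

lemma iterated_integrals_mult:
  assumes "f \<in> iterated_integrals" "g \<in> iterated_integrals"
  shows "(\<lambda>z. f z * g z) \<in> iterated_integrals"
  using assms
proof (induction arbitrary: g)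
  case (const a)
  then show ?case by (rule iterated_integrals_scale)
next
  case (add f1 f2)
  then show ?case
    using iterated_integrals.add[OF add.IH] by (simp add: distrib_right)
next
  case (integral f \<omega> F)
  have F: "F \<in> iterated_integrals"
    using integral.hyps by (rule iterated_integrals.integral)
  \<comment> \<open>The inner induction keeps \<open>F\<close> fixed, while the outer hypothesis
    remains available for every second factor: it covers \<open>f\<close> times \<open>G\<close>,
    and the inner one covers \<open>F\<close> times \<open>g\<close>.\<close>
  from integral.prems show ?case
  proof induction
    case (const a)
    then show ?case using iterated_integrals_scale[OF F, of a] by (simp add: mult.commute)
  next
    case (add g1 g2)
    then show ?case
      using iterated_integrals.add[OF add.IH] by (simp add: distrib_left)
  next
    case (integral g \<eta> G)
    have G: "G \<in> iterated_integrals"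
      using integral.hyps by (rule iterated_integrals.integral)
    obtain P where P: "P \<in> iterated_integrals"
        "ext_deriv \<A> P = fun_times_form (\<lambda>z. f z * G z) (pullback_form \<A> p \<omega>)"
      using iterated_integrals_primitive[OF \<open>\<And>g. g \<in> iterated_integrals \<Longrightarrow> (\<lambda>z. f z * g z) \<in> iterated_integrals\<close>[OF G]
          \<open>\<omega> \<in> regular_differentials C\<close>] .
    obtain Q where Q: "Q \<in> iterated_integrals"
        "ext_deriv \<A> Q = fun_times_form (\<lambda>z. F z * g z) (pullback_form \<A> p \<eta>)"
      using iterated_integrals_primitive[OF integral.IH integral.hyps(2)] .
    note holo = F[THEN iterated_integrals_holo] G[THEN iterated_integrals_holo]
      P(1)[THEN iterated_integrals_holo] Q(1)[THEN iterated_integrals_holo]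
    have "ext_deriv \<A> (\<lambda>z. F z * G z) = ext_deriv \<A> (\<lambda>z. P z + Q z)"
      unfolding ext_deriv_mult[OF holo(1,2)] ext_deriv_add[OF holo(3,4)] P(2) Q(2) integral.hyps(4)
        \<open>ext_deriv \<A> F = fun_times_form f (pullback_form \<A> p \<omega>)\<close>
      by (simp add: fun_times_form_def algebra_simps)
    from ext_deriv_eq_imp[OF holo_mult[OF holo(1,2)] holo_add[OF holo(3,4)] this]
    \<comment> \<open>The two primitives differ by a constant, read off at an arbitrary
      point.\<close>
    have "(\<lambda>z. F z * G z) = (\<lambda>z. (P z + Q z) + (F undefined * G undefined - (P undefined + Q undefined)))"
      by blast
    then show ?case
      using iterated_integrals.add[OF iterated_integrals.add[OF P(1) Q(1)] iterated_integrals.const] by metis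
  qed
qed

lemma iterated_integrals_subalgebra: "unital_subalgebra iterated_integrals"
  unfolding unital_subalgebra_def
  by (intro conjI ballI allI iterated_integrals.const iterated_integrals.add
      iterated_integrals_mult iterated_integrals_scale)

lemma integral_from_to_primitive:
  assumes "G \<in> holo_functions \<A>" "ext_deriv \<A> G = \<omega>"
  shows "integral_from_to \<A> \<omega> z0 z = G z - G z0"
  using integral_from_to_ext_deriv[OF assms(1)] assms(2) by simp

text \<open>An integral from \<open>z0\<close> is a primitive minus its value at \<open>z0\<close>;
  conversely, a primitive is such an integral plus a constant. As constants are present throughout,
  the two closure conditions amount to the same.\<close>

lemma integration_algebra_eq: "integration_algebra \<A> p C = iterated_integrals"
proof
  have "(\<lambda>z. integral_from_to \<A> (fun_times_form f (pullback_form \<A> p \<omega>)) z0 z) \<in> iterated_integrals"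
    if f: "f \<in> iterated_integrals" and \<omega>: "\<omega> \<in> regular_differentials C" for f \<omega> z0
  proof -
    obtain G where G: "G \<in> iterated_integrals" "ext_deriv \<A> G = fun_times_form f (pullback_form \<A> p \<omega>)"
      using iterated_integrals_primitive[OF f \<omega>] .
    show ?thesis
      using iterated_integrals.add[OF G(1) iterated_integrals.const[of "- G z0"]]
      by (simp add: integral_from_to_primitive[OF iterated_integrals_holo[OF G(1)] G(2)])
  qed
  then show "integration_algebra \<A> p C \<subseteq> iterated_integrals"
    unfolding integration_algebra_def
    using iterated_integrals_subalgebra iterated_integrals_holo by (intro Inter_lower) auto
next
  have "g \<in> A"
    if A: "unital_subalgebra A" and closed: "\<And>f \<omega> z0. f \<in> A \<Longrightarrow> \<omega> \<in> regular_differentials C \<Longrightarrow>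
      (\<lambda>z. integral_from_to \<A> (fun_times_form f (pullback_form \<A> p \<omega>)) z0 z) \<in> A"
      and g: "g \<in> iterated_integrals" for A g
  proof -
    note const = unital_subalgebra_const[OF A] and add = unital_subalgebra_add[OF A]
    from g show ?thesis
    proof induction
      case (integral f \<omega> G)
      from add[OF closed[OF integral.IH integral.hyps(2)] const[of "G undefined"], of undefined]
      show ?case by (simp add: integral_from_to_primitive[OF integral.hyps(3,4)])
    qed (auto intro: const add)
  qed
  then show "iterated_integrals \<subseteq> integration_algebra \<A> p C"
    unfolding integration_algebra_def by (intro Inter_greatest subsetI) auto
qed

section \<open>Acyclicity and minimality\<close>

text \<open>If \<open>G\<close> is a primitive of \<open>h\<close> times a pulled back differential,
  then \<open>f\<close> times the differential of \<open>G\<close> has the coefficient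
  \<open>f h\<close>. Closure under products puts this coefficient back into the algebra, so a
  primitive exists there.\<close>

lemma fun_times_exact:
  assumes f: "f \<in> iterated_integrals" and "g \<in> iterated_integrals"
  shows "fun_times_form f (ext_deriv \<A> g) \<in> ext_deriv \<A> ` iterated_integrals"
  using assms(2)
proof induction
  case (const a)
  have "ext_deriv \<A> (\<lambda>_. 0) = fun_times_form f (ext_deriv \<A> (\<lambda>_. a))"
    by (simp add: ext_deriv_const fun_times_form_def)
  then show ?case using iterated_integrals.const[of 0] by (metis imageI)
next
  case (add g h)
  then obtain P Q where P: "P \<in> iterated_integrals" "fun_times_form f (ext_deriv \<A> g) = ext_deriv \<A> P"
    and Q: "Q \<in> iterated_integrals" "fun_times_form f (ext_deriv \<A> h) = ext_deriv \<A> Q"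
    by blast
  have "fun_times_form f (ext_deriv \<A> (\<lambda>z. g z + h z)) =
      (\<lambda>c z. fun_times_form f (ext_deriv \<A> g) c z + fun_times_form f (ext_deriv \<A> h) c z)"
    using ext_deriv_add[OF add.hyps[THEN iterated_integrals_holo]]
    by (simp add: fun_times_form_def distrib_left)
  also have "\<dots> = ext_deriv \<A> (\<lambda>z. P z + Q z)"
    unfolding P(2) Q(2) using ext_deriv_add P(1) Q(1) iterated_integrals_holo by simp
  finally show ?case using iterated_integrals.add[OF P(1) Q(1)] by blast
next
  case (integral h \<omega> G)
  obtain P where "P \<in> iterated_integrals"
      "ext_deriv \<A> P = fun_times_form (\<lambda>z. f z * h z) (pullback_form \<A> p \<omega>)"
    using iterated_integrals_primitive[OF iterated_integrals_mult[OF f integral.hyps(1)] integral.hyps(2)] .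
  moreover have "fun_times_form f (ext_deriv \<A> G) = fun_times_form (\<lambda>z. f z * h z) (pullback_form \<A> p \<omega>)"
    unfolding integral.hyps(4) by (simp add: fun_times_form_def mult.assoc)
  ultimately show ?case by (metis imageI)
qed

lemma polynomial_pullback_iterated:
  assumes "f \<in> polynomial_functions"
  shows "(\<lambda>z. f (p z)) \<in> iterated_integrals"
proof (rule iterated_integrals.integral[OF iterated_integrals.const[of 1] _ polynomial_pullback_holo[OF assms]])
  \<comment> \<open>This is the differential of \<open>f\<close> on the curve, written as a sum of
    one term with coefficient 1, so that \<open>f \<circ> p\<close> is a primitive of its
    pullback.\<close>
  let ?\<omega> = "\<lambda>x v. if x \<in> C \<and> v \<in> tangent_space C x then \<Sum>i<1::nat. (1::complex) * differential_at f x v else 0"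
  have "(\<lambda>_. 1) \<in> polynomial_functions" by (rule polynomial_functions.const)
  then show "?\<omega> \<in> regular_differentials C"
    unfolding regular_differentials_def using assms
    by (intro CollectI exI[of _ 1] exI[of _ "\<lambda>_ _. 1"] exI[of _ "\<lambda>_. f"]) simp
  show "ext_deriv \<A> (\<lambda>z. f (p z)) = fun_times_form (\<lambda>_. 1) (pullback_form \<A> p ?\<omega>)"
    using pullback_form_eq[of 1 "\<lambda>_. f" "\<lambda>_ _. 1"] assms by (simp add: fun_times_form_def)
qed

lemma sub_dga_iterated_integrals: "sub_dga \<A> (iterated_integrals, ext_deriv \<A> ` iterated_integrals)"
  unfolding sub_dga_def split
proof (intro conjI ballI allI)
  show "iterated_integrals \<subseteq> holo_functions \<A>" using iterated_integrals_holo by blast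
  then show "ext_deriv \<A> ` iterated_integrals \<subseteq> holo_forms \<A>" using ext_deriv_holo_forms by blast
  show "unital_subalgebra iterated_integrals" by (rule iterated_integrals_subalgebra)
  show "(\<lambda>c z. 0) \<in> ext_deriv \<A> ` iterated_integrals"
    using iterated_integrals.const[of 0] ext_deriv_const[of 0] by (metis imageI)
  show "ext_deriv \<A> ` iterated_integrals \<subseteq> ext_deriv \<A> ` iterated_integrals" ..
next
  fix \<omega> \<eta> assume "\<omega> \<in> ext_deriv \<A> ` iterated_integrals" "\<eta> \<in> ext_deriv \<A> ` iterated_integrals"
  then obtain f g where fg: "f \<in> iterated_integrals" "g \<in> iterated_integrals"
    and eq: "\<omega> = ext_deriv \<A> f" "\<eta> = ext_deriv \<A> g" by blast
  show "(\<lambda>c z. \<omega> c z + \<eta> c z) \<in> ext_deriv \<A> ` iterated_integrals"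
    unfolding eq ext_deriv_add[OF fg[THEN iterated_integrals_holo], symmetric]
    by (intro imageI iterated_integrals.add fg)
next
  fix a \<omega> assume "\<omega> \<in> ext_deriv \<A> ` iterated_integrals"
  then obtain f where f: "f \<in> iterated_integrals" "\<omega> = ext_deriv \<A> f" by blast
  have "(\<lambda>c z. a * \<omega> c z) = ext_deriv \<A> (\<lambda>z. a * f z)"
    using ext_deriv_mult[OF holo_const[of a] iterated_integrals_holo[OF f(1)]] f(2)
    by (simp add: ext_deriv_const)
  then show "(\<lambda>c z. a * \<omega> c z) \<in> ext_deriv \<A> ` iterated_integrals"
    using iterated_integrals_scale[OF f(1)] by blast
next
  fix f \<omega> assume "f \<in> iterated_integrals" "\<omega> \<in> ext_deriv \<A> ` iterated_integrals"
  then show "fun_times_form f \<omega> \<in> ext_deriv \<A> ` iterated_integrals"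
    using fun_times_exact by blast
qed

lemma acyclic_extension_iterated_integrals:
  "acyclic_extension \<A> p C (iterated_integrals, ext_deriv \<A> ` iterated_integrals)"
proof -
  have "f \<circ> p \<in> iterated_integrals" if f: "f \<in> regular_functions C" for f
  proof -
    obtain g where g: "g \<in> polynomial_functions" "f = restrict g C"
      using f unfolding regular_functions_def by blast
    have "f \<circ> p = (\<lambda>z. g (p z))" using g(2) cover_in_curve by (simp add: fun_eq_iff)
    then show ?thesis using polynomial_pullback_iterated[OF g(1)] by simp
  qed
  moreover have "pullback_form \<A> p \<omega> \<in> ext_deriv \<A> ` iterated_integrals"
    if \<omega>: "\<omega> \<in> regular_differentials C" for \<omega>
  proof -
    obtain G where "G \<in> iterated_integrals" "ext_deriv \<A> G = fun_times_form (\<lambda>_. 1) (pullback_form \<A> p \<omega>)"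
      using iterated_integrals_primitive[OF iterated_integrals.const \<omega>] .
    moreover have "fun_times_form (\<lambda>_. 1) (pullback_form \<A> p \<omega>) = pullback_form \<A> p \<omega>"
      by (simp add: fun_times_form_def)
    ultimately show ?thesis by (metis imageI)
  qed
  ultimately show ?thesis
    unfolding acyclic_extension_def split
    by (intro conjI sub_dga_iterated_integrals image_subsetI refl)
qed

lemma iterated_integrals_minimal:
  assumes "acyclic_extension \<A> p C (E0, E1)" "f \<in> iterated_integrals"
  shows "f \<in> E0"
proof -
  note ae = assms(1)[unfolded acyclic_extension_def sub_dga_def split]
  have holo: "E0 \<subseteq> holo_functions \<A>" using ae by (elim conjE)
  have alg: "unital_subalgebra E0" using ae by (elim conjE)
  have mult: "\<forall>f \<in> E0. \<forall>\<omega> \<in> E1. fun_times_form f \<omega> \<in> E1" using ae by (elim conjE)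
  have pull: "pullback_form \<A> p ` regular_differentials C \<subseteq> E1" using ae by (elim conjE)
  have exact: "E1 = ext_deriv \<A> ` E0" using ae by (elim conjE)
  from assms(2) show ?thesis
  proof induction
    case (const a)
    show ?case using alg by (rule unital_subalgebra_const)
  next
    case (add f g)
    show ?case using alg add.IH by (rule unital_subalgebra_add)
  next
    case (integral f \<omega> G)
    have "pullback_form \<A> p \<omega> \<in> E1" using pull integral.hyps(2) by blast
    with mult integral.IH have "ext_deriv \<A> G \<in> E1"
      unfolding integral.hyps(4) by blast
    then obtain H where H: "H \<in> E0" "ext_deriv \<A> G = ext_deriv \<A> H"
      unfolding exact by blast
    \<comment> \<open>\<open>G\<close> itself is not given as an element of \<open>E0\<close>; it is
      recovered from \<open>H\<close> by adding a constant, which the unital algebra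
      contains.\<close>
    have "G = (\<lambda>z. H z + (G undefined - H undefined))"
      using ext_deriv_eq_imp[OF integral.hyps(3) subsetD[OF holo H(1)] H(2)] by (intro ext)
    also have "\<dots> \<in> E0"
      by (intro unital_subalgebra_add[OF alg] unital_subalgebra_const[OF alg] H(1))
    finally show ?case .
  qed
qed

theorem minimal_acyclic_extension_eq:
  "minimal_acyclic_extension \<A> p C =
     (integration_algebra \<A> p C, ext_deriv \<A> ` integration_algebra \<A> p C)"
proof -
  let ?AE = "{E. acyclic_extension \<A> p C E}"
  have mem: "(iterated_integrals, ext_deriv \<A> ` iterated_integrals) \<in> ?AE"
    using acyclic_extension_iterated_integrals by blast
  have sub: "iterated_integrals \<subseteq> fst E" "ext_deriv \<A> ` iterated_integrals \<subseteq> snd E" if "E \<in> ?AE" for E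
  proof -
    have E: "acyclic_extension \<A> p C (fst E, snd E)" using that by simp
    show *: "iterated_integrals \<subseteq> fst E" using iterated_integrals_minimal[OF E] by blast
    \<comment> \<open>Acyclicity determines degree one from degree zero, so the lower bound in
      degree zero passes to degree one.\<close>
    have "snd E = ext_deriv \<A> ` fst E" using E unfolding acyclic_extension_def split by blast
    then show "ext_deriv \<A> ` iterated_integrals \<subseteq> snd E" using * by blast
  qed
  have "(\<Inter>E\<in>?AE. fst E) = iterated_integrals"
    using INT_lower[OF mem, of fst] sub(1) by (intro equalityI INT_greatest) auto
  moreover have "(\<Inter>E\<in>?AE. snd E) = ext_deriv \<A> ` iterated_integrals"
    using INT_lower[OF mem, of snd] sub(2) by (intro equalityI INT_greatest) auto
  ultimately show ?thesis
    unfolding minimal_acyclic_extension_def integration_algebra_eq by simp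
qed

end

theorem proposition8p5:
  fixes C :: "(complex ^ 'n) set"
    and \<A> :: "'a::t2_space chart set"
    and p :: "'a \<Rightarrow> complex ^ 'n"
  assumes "smooth_connected_affine_curve C"
    and "universal_cover \<A> p C"
  shows "minimal_acyclic_extension \<A> p C =
           (integration_algebra \<A> p C, ext_deriv \<A> ` integration_algebra \<A> p C)"
proof -
  interpret affine_cover \<A> p C
    using assms(2) by unfold_locales
  show ?thesis by (rule minimal_acyclic_extension_eq)
qed

end
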